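(* An Abelian topological group is compact if and only if it is $\mathsf{e}{:}\mathsf{sTG}$-closed.
   Context: All topological groups and semitopological groups are assumed Hausdorff. A semitopological group is a group $G$ with a topology for which the multiplication is separately continuous (i.e. all left and right shifts are continuous). A topological group $X$ is $\mathsf{e}{:}\mathsf{sTG}$-closed if for every Hausdorff semitopological group $Y$ and every homomorphism $f:X\to Y$ that is a topological embedding, the image $f(X)$ is closed in $Y$. *)

theory Defs
  imports "HOL-Analysis.Analysis" "HOL-Algebra.Group"
begin

text \<open>
  Groups are HOL-Algebra groups and topologies are abstract topologies on the carrier.
  The Hausdorff property is not part of these locales; it is assumed separately.
\<close>

locale semitopological_group = group G
  for G :: "('a, 'm) monoid_scheme" (structure) +
  fixes T :: "'a topology"
  assumes topspace_eq: "topspace T = carrier G"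
    and continuous_left_shift: "a \<in> carrier G \<Longrightarrow> continuous_map T T (\<lambda>x. a \<otimes> x)"
    and continuous_right_shift: "a \<in> carrier G \<Longrightarrow> continuous_map T T (\<lambda>x. x \<otimes> a)"

locale topological_group = group G
  for G :: "('a, 'm) monoid_scheme" (structure) +
  fixes T :: "'a topology"
  assumes topspace_eq: "topspace T = carrier G"
    and continuous_mult: "continuous_map (prod_topology T T) T (\<lambda>(x, y). x \<otimes> y)"
    and continuous_inv: "continuous_map T T (\<lambda>x. inv x)"

text \<open>
  HOL cannot quantify over all types inside a formula, so \<open>e_sTG_closed TYPE('b) G T\<close>
  lets \<open>Y\<close> range over all Hausdorff semitopological groups whose carrier is any subset of
  the type \<open>'b\<close>. This is immaterial if the carrier of \<open>G\<close> embeds into \<open>'b\<close>: by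
  \<open>e_sTG_closed_any_type\<close> below, \<open>G\<close> is then closed in \<open>Y\<close> over every other type as well.
  Instantiating \<open>'b\<close> with \<open>'a + 'c\<close>, where \<open>G\<close> lives on \<open>'a\<close>, guarantees such an embedding
  and includes a copy of every \<open>Y\<close> over the arbitrary type \<open>'c\<close>.
\<close>

definition e_sTG_closed :: "'b itself \<Rightarrow> ('a, 'm) monoid_scheme \<Rightarrow> 'a topology \<Rightarrow> bool" where
  "e_sTG_closed _ G T \<longleftrightarrow>
     (\<forall>(Y :: 'b monoid) S f.
        semitopological_group Y S \<and> Hausdorff_space S \<and>
        f \<in> hom G Y \<and> embedding_map T S f \<longrightarrow>
        closedin S (f ` carrier G))"

lemma (in group) small_subgroup:
  assumes A: "A \<subseteq> carrier G" and inf: "infinite A"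
  shows "\<exists>H. subgroup H G \<and> A \<subseteq> H \<and> H \<lesssim> A"
proof -
  define L where "L = rec_nat (insert \<one> A) (\<lambda>_ B. (\<lambda>(x, y). x \<otimes> inv y) ` (B \<times> B))"
  have L0: "L 0 = insert \<one> A" and LS: "L (Suc n) = (\<lambda>(x, y). x \<otimes> inv y) ` (L n \<times> L n)" for n
    by (auto simp: L_def)
  have car: "L n \<subseteq> carrier G" for n
    by (induction n) (use A in \<open>auto simp: L0 LS\<close>)
  have one: "\<one> \<in> L n" for n
  proof (induction n)
    case (Suc n)
    have "\<one> = (\<lambda>(x, y). x \<otimes> inv y) (\<one>, \<one>)" by simp
    then show ?case unfolding LS using Suc by blast
  qed (simp add: L0)
  have step: "L n \<subseteq> L (Suc n)" for n
  proof
    fix x assume x: "x \<in> L n"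
    then have "x = (\<lambda>(x, y). x \<otimes> inv y) (x, \<one>)" using car[of n] by (auto simp: subset_iff)
    then show "x \<in> L (Suc n)" unfolding LS using x one by blast
  qed
  have mono: "m \<le> n \<Longrightarrow> L m \<subseteq> L n" for m n
    using lift_Suc_mono_le[of L m n] step by blast
  have card: "(card_of (L n), card_of A) \<in> ordLeq" for n
  proof (induction n)
    case 0
    have "(card_of (insert \<one> A), card_of A) \<in> ordLeq"
      using infinite_insert_lepoll[OF inf] unfolding lepoll_def card_of_ordLeq .
    then show ?case by (simp add: L0)
  next
    case (Suc n)
    have "(card_of (L n \<times> L n), card_of A) \<in> ordLeq"
      by (rule card_of_Sigma_ordLeq_infinite[OF inf Suc]) (simp add: Suc)
    then show ?case unfolding LS by (rule ordLeq_transitive[OF card_of_image])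
  qed
  define H where "H = (\<Union>n. L n)"
  have diff: "x \<otimes> inv y \<in> H" if xy: "x \<in> H" "y \<in> H" for x y
  proof -
    obtain m n where "x \<in> L m" "y \<in> L n" using xy by (auto simp: H_def)
    then have "x \<in> L (max m n)" "y \<in> L (max m n)"
      using mono[of m "max m n"] mono[of n "max m n"] by auto
    then have "(\<lambda>(x, y). x \<otimes> inv y) (x, y) \<in> L (Suc (max m n))" unfolding LS by blast
    then show ?thesis by (auto simp: H_def)
  qed
  have Hcar: "H \<subseteq> carrier G" using car by (auto simp: H_def)
  have oneH: "\<one> \<in> H" using one by (auto simp: H_def)
  have invH: "inv y \<in> H" if "y \<in> H" for y
    using diff[OF oneH that] that Hcar by auto
  have "subgroup H G"
  proof (rule subgroupI)
    fix a b assume ab: "a \<in> H" "b \<in> H"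
    then show "a \<otimes> b \<in> H" using diff[OF ab(1) invH[OF ab(2)]] Hcar by auto
  qed (use Hcar oneH invH in auto)
  moreover have "A \<subseteq> H" using L0 by (auto simp: H_def)
  moreover have "(card_of H, card_of A) \<in> ordLeq"
    unfolding H_def
  proof (rule card_of_UNION_ordLeq_infinite[OF inf])
    show "(card_of (UNIV :: nat set), card_of A) \<in> ordLeq"
      using inf by (simp add: infinite_iff_card_of_nat)
  qed (simp add: card)
  ultimately show ?thesis unfolding lepoll_def card_of_ordLeq by blast
qed

proposition e_sTG_closed_any_type:
  fixes G :: "('a, 'm) monoid_scheme"
  assumes top: "topspace T = carrier G"
    and closed: "e_sTG_closed TYPE('b) G T"
    and size: "carrier G \<lesssim> (UNIV :: 'b set)"
  shows "e_sTG_closed TYPE('c) G T"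
  unfolding e_sTG_closed_def
proof (intro allI impI, elim conjE)
  fix Y :: "'c monoid" and S f
  assume Y: "semitopological_group Y S" and Haus: "Hausdorff_space S"
    and hom: "f \<in> hom G Y" and emb: "embedding_map T S f"
  interpret Y: semitopological_group Y S by fact
  let ?F = "f ` carrier G"
  have FY: "?F \<subseteq> carrier Y" using hom by (auto simp: hom_def)
  have inj: "inj_on f (carrier G)" using emb top by (metis embedding_map_def homeomorphic_imp_injective_map)
  show "closedin S ?F"
  proof (cases "finite ?F")
    case True
    then show ?thesis
      using Haus FY Y.topspace_eq closedin_Hausdorff_finite by metis
  next
    case False
    have "S closure_of ?F \<subseteq> ?F"
    proof
      fix y assume y: "y \<in> S closure_of ?F"
      then have yY: "y \<in> carrier Y" using Y.topspace_eq closure_of_subset_topspace by fastforce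
      let ?A = "insert y ?F"
      have "?A \<subseteq> carrier Y" "infinite ?A" using FY yY False by auto
      from Y.small_subgroup[OF this] obtain H where H: "subgroup H Y" "?A \<subseteq> H"
        "H \<lesssim> ?A" by blast
      have "?A \<lesssim> ?F" by (rule infinite_insert_lepoll[OF False])
      moreover have "?F \<lesssim> carrier G" by (rule image_lepoll)
      ultimately have "H \<lesssim> (UNIV :: 'b set)"
        using H(3) size by (meson lepoll_trans)
      then obtain g :: "'c \<Rightarrow> 'b" where g: "inj_on g H"
        unfolding lepoll_def by blast
      have HY: "H \<subseteq> carrier Y" using H(1) by (rule subgroup.subset)
      define k where "k = inv_into H g"
      have kg: "k (g h) = h" if "h \<in> H" for h using g that by (simp add: k_def)
      have kgf: "k (g (f x)) = f x" if "x \<in> carrier G" for x using kg H(2) that by auto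
      define Z where "Z = \<lparr>carrier = g ` H, monoid.mult = (\<lambda>u v. g (k u \<otimes>\<^bsub>Y\<^esub> k v)), one = g \<one>\<^bsub>Y\<^esub>\<rparr>"
      define R where "R = pullback_topology (g ` H) k (subtopology S H)"
      interpret YH: group "Y\<lparr>carrier := H\<rparr>" by (rule Y.subgroup_imp_group[OF H(1)])
      have mH: "a \<otimes>\<^bsub>Y\<^esub> b \<in> H" if "a \<in> H" "b \<in> H" for a b using H(1) that by (rule subgroup.m_closed)
      have oH: "\<one>\<^bsub>Y\<^esub> \<in> H" using H(1) by (rule subgroup.one_closed)
      have topSH: "topspace (subtopology S H) = H" using HY Y.topspace_eq by auto
      have topR: "topspace R = g ` H" unfolding R_def topspace_pullback_topology topSH using kg by auto
      have contk: "continuous_map R (subtopology S H) k"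
        unfolding R_def using continuous_map_pullback[OF continuous_map_id] by simp
      have contg: "continuous_map (subtopology S H) R g"
        unfolding R_def
      proof (rule continuous_map_pullback')
        show "continuous_map (subtopology S H) (subtopology S H) (k \<circ> g)"
          by (rule continuous_map_eq[OF continuous_map_id]) (use kg topSH in auto)
      qed (use topSH in auto)
      have homeo: "homeomorphic_maps (subtopology S H) R g k"
        unfolding homeomorphic_maps_def using contk contg kg topR topSH by auto
      have groupZ: "group Z"
      proof (rule groupI)
        fix u assume "u \<in> carrier Z"
        then obtain a where a: "a \<in> H" "u = g a" by (auto simp: Z_def)
        then have "inv\<^bsub>Y\<^esub> a \<in> H" "inv\<^bsub>Y\<^esub> a \<otimes>\<^bsub>Y\<^esub> a = \<one>\<^bsub>Y\<^esub>"
          using H(1) HY subgroup.m_inv_closed by auto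
        then show "\<exists>v\<in>carrier Z. v \<otimes>\<^bsub>Z\<^esub> u = \<one>\<^bsub>Z\<^esub>"
          using a kg by (auto simp: Z_def intro!: bexI[of _ "inv\<^bsub>Y\<^esub> a"])
      qed (use kg mH oH HY Y.m_assoc in \<open>auto simp: Z_def subset_iff\<close>)
      have "semitopological_group Z R"
      proof (intro semitopological_group.intro groupZ semitopological_group_axioms.intro)
        show "topspace R = carrier Z" by (simp add: topR Z_def)
      next
        fix u assume "u \<in> carrier Z"
        then have ku: "k u \<in> H" using kg by (auto simp: Z_def)
        have sub: "continuous_map (subtopology S H) (subtopology S H) s"
          if "continuous_map S S s" "s ` H \<subseteq> H" for s
          using that by (auto simp: continuous_map_in_subtopology continuous_map_from_subtopology)
        have "continuous_map (subtopology S H) (subtopology S H) (\<lambda>x. k u \<otimes>\<^bsub>Y\<^esub> x)"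
          by (rule sub[OF Y.continuous_left_shift]) (use ku HY mH in auto)
        then have "continuous_map R R (g \<circ> ((\<lambda>x. k u \<otimes>\<^bsub>Y\<^esub> x) \<circ> k))"
          by (intro continuous_map_compose[OF _ contg] continuous_map_compose[OF contk])
        then show "continuous_map R R (\<lambda>x. u \<otimes>\<^bsub>Z\<^esub> x)" by (simp add: Z_def o_def)
        have "continuous_map (subtopology S H) (subtopology S H) (\<lambda>x. x \<otimes>\<^bsub>Y\<^esub> k u)"
          by (rule sub[OF Y.continuous_right_shift]) (use ku HY mH in auto)
        then have "continuous_map R R (g \<circ> ((\<lambda>x. x \<otimes>\<^bsub>Y\<^esub> k u) \<circ> k))"
          by (intro continuous_map_compose[OF _ contg] continuous_map_compose[OF contk])
        then show "continuous_map R R (\<lambda>x. x \<otimes>\<^bsub>Z\<^esub> u)" by (simp add: Z_def o_def)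
      qed
      moreover have "Hausdorff_space R"
        using homeo Haus Hausdorff_space_subtopology homeomorphic_Hausdorff_space
          homeomorphic_space_def by blast
      moreover have "g \<circ> f \<in> hom G Z"
        using hom H(2) kgf unfolding hom_def by (auto simp: Z_def Pi_iff)
      moreover have "embedding_map T R (g \<circ> f)"
      proof (rule embedding_map_compose)
        show "embedding_map T (subtopology S H) f"
          using emb H(2) top by (simp add: embedding_map_in_subtopology)
        show "embedding_map (subtopology S H) R g"
          using homeo by (metis surjective_embedding_map homeomorphic_map_maps)
      qed
      ultimately have "closedin R ((g \<circ> f) ` carrier G)"
        using closed unfolding e_sTG_closed_def by blast
      then have cl: "closedin R (g ` ?F)" by (simp add: image_comp)
      have "closedin (subtopology S H) {x \<in> topspace (subtopology S H). g x \<in> g ` ?F}"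
        by (rule closedin_continuous_map_preimage[OF contg cl])
      moreover have "{x \<in> topspace (subtopology S H). g x \<in> g ` ?F} = ?F"
        unfolding topSH using inj_on_image_mem_iff[OF g, of _ ?F] H(2) by blast
      ultimately have "closedin (subtopology S H) ?F" by simp
      then obtain C where C: "closedin S C" "?F = C \<inter> H" by (auto simp: closedin_subtopology)
      then have "S closure_of ?F \<subseteq> C" by (metis closure_of_minimal inf_le1)
      then show "y \<in> ?F" using y C H(2) by blast
    qed
    then show ?thesis
      using FY by (simp add: Y.topspace_eq flip: closure_of_subset_eq)
  qed
qed

end

theory Submission
  imports Defs "HOL-Algebra.FiniteProduct" "HOL-Algebra.Elementary_Groups"
begin

text \<open>
  A compact group has compact, hence closed, images in Hausdorff spaces. For the converse, compactness is
  split into total boundedness and completeness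
  (\<open>totally_bounded_complete_imp_compact\<close>), and if either one fails, a Hausdorff semitopological group
  is constructed in which \<open>G\<close> is embedded but not closed. Both constructions extend \<open>G\<close> by one
  generator, that is, they start from \<open>G \<times> \<int>\<close>, and make the new generator a limit of elements of \<open>G\<close>.

  If \<open>G\<close> is not totally bounded, there are a neighbourhood \<open>V\<close> of the unit and a sequence \<open>a\<close> such that
  quotients of distinct finite products of terms of \<open>a\<close> stay outside \<open>V\<close>
  (\<open>not_totally_bounded_free_sequence\<close>). Give \<open>G \<times> \<int>\<close> the finest topology with continuous
  translations that respects the topology of \<open>G\<close> and in which \<open>(a k, 1)\<close> tends to the unit, so that
  \<open>(a k, 0)\<close> tends to \<open>(\<one>, - 1)\<close>, which is not in \<open>G\<close>. Since the multiplication need not be jointly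
  continuous, this topology has very small open sets, the fans. That different points have disjoint fans
  is where the freeness of \<open>a\<close> is used (\<open>Hausdorff_limit_topology\<close>).

  If a Cauchy filter \<open>F\<close> has no limit, \<open>G\<close> is extended by the limit that \<open>F\<close> has in the completion,
  without constructing the completion. A pair \<open>(x, n)\<close> is declared close to the unit if \<open>x \<otimes> a [^] n\<close>
  is so for \<open>F\<close>-almost all \<open>a\<close>. Dividing \<open>G \<times> \<int>\<close> by the elements that are arbitrarily close to the unit
  yields a Hausdorff topological group that contains \<open>G\<close>. The Cauchy property puts the class of
  \<open>(\<one>, 1)\<close> into the closure of \<open>G\<close>, and it belongs to \<open>G\<close> only if \<open>F\<close> converges
  (\<open>e_sTG_closed_imp_cauchy_convergent\<close>).

  The extensions live on other types than \<open>G\<close>; \<open>e_sTG_closed_any_type\<close> transfers the closedness there.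
\<close>

section \<open>Preliminaries on abelian groups and embeddings\<close>

lemma (in comm_group) mult_div_mult_cancel:
  assumes "p \<in> carrier G" "q \<in> carrier G" "r \<in> carrier G" "x \<in> carrier G"
  shows "(p \<otimes> x) \<otimes> inv (r \<otimes> (q \<otimes> x)) = (p \<otimes> inv q) \<otimes> inv r"
proof -
  have "(p \<otimes> x) \<otimes> (r' \<otimes> (q' \<otimes> x')) = ((p \<otimes> q') \<otimes> r') \<otimes> (x \<otimes> x')"
    if "r' \<in> carrier G" "q' \<in> carrier G" "x' \<in> carrier G" for r' q' x'
    using assms that by (simp add: m_ac)
  from this[of "inv r" "inv q" "inv x"] show ?thesis using assms by (simp add: inv_mult)
qed

lemma (in comm_group) cross_quotient_eq:
  assumes "p \<in> carrier G" "q \<in> carrier G" "p' \<in> carrier G" "q' \<in> carrier G"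
    "s \<in> carrier G" "s' \<in> carrier G"
    and eq: "d = (p \<otimes> inv q) \<otimes> s" "d = (p' \<otimes> inv q') \<otimes> s'"
  shows "(p \<otimes> q') \<otimes> inv (q \<otimes> p') = s' \<otimes> inv s"
proof -
  have "p \<otimes> inv q \<otimes> s = p' \<otimes> inv q' \<otimes> s'" using eq by simp
  then have "(p \<otimes> inv q \<otimes> s) \<otimes> (inv s \<otimes> inv p' \<otimes> q') = (p' \<otimes> inv q' \<otimes> s') \<otimes> (inv s \<otimes> inv p' \<otimes> q')" by simp
  moreover have "(p \<otimes> r \<otimes> s) \<otimes> (i \<otimes> t \<otimes> q') = (p \<otimes> q') \<otimes> (r \<otimes> t) \<otimes> (s \<otimes> i)"
    if "r \<in> carrier G" "i \<in> carrier G" "t \<in> carrier G" for r i t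
    using assms that by (simp add: m_ac)
  from this[of "inv q" "inv s" "inv p'"]
  have "(p \<otimes> inv q \<otimes> s) \<otimes> (inv s \<otimes> inv p' \<otimes> q') = (p \<otimes> q') \<otimes> inv (q \<otimes> p')"
    using assms by (simp add: inv_mult)
  moreover have "(p' \<otimes> r \<otimes> s') \<otimes> (i \<otimes> t \<otimes> q') = (s' \<otimes> i) \<otimes> (p' \<otimes> t) \<otimes> (q' \<otimes> r)"
    if "r \<in> carrier G" "i \<in> carrier G" "t \<in> carrier G" for r i t
    using assms that by (simp add: m_ac)
  from this[of "inv q'" "inv s" "inv p'"]
  have "(p' \<otimes> inv q' \<otimes> s') \<otimes> (inv s \<otimes> inv p' \<otimes> q') = s' \<otimes> inv s"
    using assms by simp
  ultimately show ?thesis by simp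
qed

lemma (in comm_group) quotient_eq_of_cancelled_products:
  assumes "x \<in> carrier G" "y \<in> carrier G" "v \<in> carrier G" "w \<in> carrier G"
    "p \<in> carrier G" "q \<in> carrier G"
    and eq: "(x \<otimes> v) \<otimes> p = (y \<otimes> w) \<otimes> q"
  shows "x \<otimes> inv y = (q \<otimes> inv p) \<otimes> (w \<otimes> inv v)"
proof -
  have "x \<otimes> inv y = ((x \<otimes> v) \<otimes> p) \<otimes> (inv v \<otimes> inv p \<otimes> inv y)"
  proof -
    have "((x \<otimes> v) \<otimes> p) \<otimes> (a \<otimes> b \<otimes> c) = (x \<otimes> c) \<otimes> (v \<otimes> a) \<otimes> (p \<otimes> b)"
      if "a \<in> carrier G" "b \<in> carrier G" "c \<in> carrier G" for a b c
      using assms(1-6) that by (simp add: m_ac)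
    from this[of "inv v" "inv p" "inv y"] show ?thesis using assms(1-6) by simp
  qed
  also have "\<dots> = ((y \<otimes> w) \<otimes> q) \<otimes> (inv v \<otimes> inv p \<otimes> inv y)" using eq by simp
  also have "\<dots> = (q \<otimes> inv p) \<otimes> (w \<otimes> inv v)"
  proof -
    have "((y \<otimes> w) \<otimes> q) \<otimes> (a \<otimes> b \<otimes> c) = (q \<otimes> b) \<otimes> (w \<otimes> a) \<otimes> (y \<otimes> c)"
      if "a \<in> carrier G" "b \<in> carrier G" "c \<in> carrier G" for a b c
      using assms(1-6) that by (simp add: m_ac)
    from this[of "inv v" "inv p" "inv y"] show ?thesis using assms(1-6) by simp
  qed
  finally show ?thesis .
qed

text \<open>
  Being Hausdorff makes the separating open sets yield injectivity as well.
\<close>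

lemma embedding_mapI_separating_opens:
  assumes Haus: "Hausdorff_space T" and cont: "continuous_map T S f"
    and opens: "\<And>U. openin T U \<Longrightarrow> \<exists>V. openin S V \<and> (\<forall>x\<in>topspace T. f x \<in> V \<longleftrightarrow> x \<in> U)"
  shows "embedding_map T S f"
  unfolding embedding_map_def
proof (rule bijective_open_imp_homeomorphic_map)
  let ?R = "subtopology S (f ` topspace T)"
  show "continuous_map T ?R f"
    using cont by (auto simp: continuous_map_in_subtopology)
  show "open_map T ?R f"
    unfolding open_map_def
  proof (intro allI impI)
    fix U assume U: "openin T U"
    obtain V where V: "openin S V" "\<forall>x\<in>topspace T. f x \<in> V \<longleftrightarrow> x \<in> U"
      using opens[OF U] by blast
    have "f ` U = V \<inter> f ` topspace T"
      using V(2) openin_subset[OF U] by blast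
    then show "openin ?R (f ` U)" using V(1) by (auto simp: openin_subtopology)
  qed
  show "f ` topspace T = topspace ?R"
    using continuous_map_image_subset_topspace[OF cont] by auto
  show "inj_on f (topspace T)"
  proof (rule inj_onI, rule ccontr)
    fix x y assume xy: "x \<in> topspace T" "y \<in> topspace T" "f x = f y" "x \<noteq> y"
    have "openin T (topspace T - {y})"
      using openin_diff[OF openin_topspace closedin_Hausdorff_singleton[OF Haus xy(2)]] .
    then obtain V where V: "\<forall>z\<in>topspace T. f z \<in> V \<longleftrightarrow> z \<in> topspace T - {y}"
      using opens[of "topspace T - {y}"] by auto
    have "f x \<in> V" "f y \<notin> V" using V xy(1,2,4) by blast+
    then show False using xy(3) by simp
  qed
qed

section \<open>Neighbourhoods of the unit and total boundedness\<close>

context topological_group begin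

lemma openin_carrier: "openin T U \<Longrightarrow> U \<subseteq> carrier G"
  using openin_subset topspace_eq by blast

lemma continuous_map_translation:
  assumes "a \<in> carrier G"
  shows "continuous_map T T (\<lambda>x. a \<otimes> x)"
proof -
  have "continuous_map T (prod_topology T T) (\<lambda>x. (a, x))"
    using assms topspace_eq by (auto simp: continuous_map_pairwise o_def)
  then show ?thesis
    using continuous_map_compose[OF _ continuous_mult, of T "\<lambda>x. (a, x)"] by (simp add: o_def)
qed

lemma openin_translation_vimage:
  assumes "a \<in> carrier G" "openin T U"
  shows "openin T {x \<in> carrier G. a \<otimes> x \<in> U}"
  using openin_continuous_map_preimage[OF continuous_map_translation] assms
  by (simp add: topspace_eq)

lemma openin_translation:
  assumes a: "a \<in> carrier G" and U: "openin T U"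
  shows "openin T ((\<lambda>x. a \<otimes> x) ` U)"
proof -
  have "(\<lambda>x. a \<otimes> x) ` U = {x \<in> carrier G. inv a \<otimes> x \<in> U}" (is "?L = ?R")
  proof
    show "?L \<subseteq> ?R" using a openin_carrier[OF U] by (auto simp: subset_iff m_assoc[symmetric])
    show "?R \<subseteq> ?L"
    proof
      fix x assume "x \<in> ?R"
      then have "x = a \<otimes> (inv a \<otimes> x)" "inv a \<otimes> x \<in> U" using a by (auto simp: m_assoc[symmetric])
      then show "x \<in> ?L" by blast
    qed
  qed
  then show ?thesis using openin_translation_vimage[OF inv_closed[OF a] U] by simp
qed

definition nbhds_one :: "'a set set" where
  "nbhds_one = {V. openin T V \<and> \<one> \<in> V}"

lemma nbhds_one_translate:
  assumes "openin T U" "x \<in> U"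
  shows "{v \<in> carrier G. x \<otimes> v \<in> U} \<in> nbhds_one"
  using assms openin_carrier[OF assms(1)] openin_translation_vimage
  unfolding nbhds_one_def by auto

lemma nbhds_one_div:
  assumes "V \<in> nbhds_one"
  obtains W where "W \<in> nbhds_one" "\<And>v w. v \<in> W \<Longrightarrow> w \<in> W \<Longrightarrow> v \<otimes> inv w \<in> V"
proof -
  let ?f = "\<lambda>(x, y). x \<otimes> inv y"
  have "continuous_map (prod_topology T T) (prod_topology T T) (\<lambda>(x, y). (x, inv y))"
    using continuous_map_prod_top[of T T T T "\<lambda>x. x" "\<lambda>x. inv x"] continuous_inv by simp
  from continuous_map_compose[OF this continuous_mult]
  have cont: "continuous_map (prod_topology T T) T ?f"
    by (simp add: o_def case_prod_unfold)
  have V: "openin T V" "\<one> \<in> V" using assms by (auto simp: nbhds_one_def)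
  define Q where "Q = {p \<in> topspace (prod_topology T T). ?f p \<in> V}"
  have Q: "openin (prod_topology T T) Q" "(\<one>, \<one>) \<in> Q"
    using openin_continuous_map_preimage[OF cont V(1)] V(2) topspace_eq by (auto simp: Q_def)
  then have "\<exists>A B. openin T A \<and> openin T B \<and> \<one> \<in> A \<and> \<one> \<in> B \<and> A \<times> B \<subseteq> Q"
    by (simp add: openin_prod_topology_alt)
  then obtain A B where AB: "openin T A" "openin T B" "\<one> \<in> A" "\<one> \<in> B" "A \<times> B \<subseteq> Q" by auto
  show ?thesis
  proof
    show "A \<inter> B \<in> nbhds_one" using AB by (auto simp: nbhds_one_def)
    show "v \<otimes> inv w \<in> V" if "v \<in> A \<inter> B" "w \<in> A \<inter> B" for v w
      using AB(5) that by (auto simp: Q_def)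
  qed
qed

lemma nbhds_one_inter: "V \<in> nbhds_one \<Longrightarrow> W \<in> nbhds_one \<Longrightarrow> V \<inter> W \<in> nbhds_one"
  by (auto simp: nbhds_one_def)

lemma nbhds_one_carrier: "V \<in> nbhds_one \<Longrightarrow> V \<subseteq> carrier G"
  using openin_carrier by (auto simp: nbhds_one_def)

lemma nbhds_one_inv:
  assumes "V \<in> nbhds_one"
  shows "{x \<in> carrier G. inv x \<in> V} \<in> nbhds_one"
  using openin_continuous_map_preimage[OF continuous_inv] assms
  by (auto simp: nbhds_one_def topspace_eq)

text \<open>
  The translates are written with \<open>c \<otimes> inv x\<close>, the quotient that also expresses that the point \<open>c\<close>
  is close to the elements of a Cauchy filter below.
\<close>

definition totally_bounded :: bool where
  "totally_bounded \<longleftrightarrow>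
     (\<forall>V\<in>nbhds_one. \<exists>C\<subseteq>carrier G. finite C \<and> (\<forall>x\<in>carrier G. \<exists>c\<in>C. c \<otimes> inv x \<in> V))"

definition cauchy_filter :: "'a filter \<Rightarrow> bool" where
  "cauchy_filter F \<longleftrightarrow> (\<forall>V\<in>nbhds_one. \<exists>c\<in>carrier G. \<forall>\<^sub>F x in F. c \<otimes> inv x \<in> V)"

end

section \<open>Groups that are not totally bounded\<close>

locale abelian_topological_group = topological_group G T + comm_group G
  for G :: "('a, 'm) monoid_scheme" (structure) and T
begin

text \<open>
  If finitely many translates of \<open>V\<close> never cover \<open>G\<close>, then \<open>a k\<close> can be chosen outside the translates
  of \<open>V\<close> by all quotients of products of earlier terms, which are finitely many. Two different finite
  products are then told apart by the largest index at which they differ.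
\<close>

lemma not_totally_bounded_free_sequence:
  assumes "\<not> totally_bounded"
  obtains V a where "V \<in> nbhds_one" "\<And>k::nat. a k \<in> carrier G"
    "\<And>K L. \<lbrakk>finite K; finite L; K \<noteq> L\<rbrakk> \<Longrightarrow> finprod G a K \<otimes> inv (finprod G a L) \<notin> V"
proof -
  obtain V0 where V0: "V0 \<in> nbhds_one"
    and unbdd: "\<And>C. C \<subseteq> carrier G \<Longrightarrow> finite C \<Longrightarrow> \<exists>x\<in>carrier G. \<forall>c\<in>C. c \<otimes> inv x \<notin> V0"
  proof -
    obtain V0 where V0: "V0 \<in> nbhds_one" and "\<not> (\<exists>C\<subseteq>carrier G. finite C \<and> (\<forall>x\<in>carrier G. \<exists>c\<in>C. c \<otimes> inv x \<in> V0))"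
      using assms unfolding totally_bounded_def by auto
    then have "\<exists>x\<in>carrier G. \<forall>c\<in>C. c \<otimes> inv x \<notin> V0" if "C \<subseteq> carrier G" "finite C" for C
      using that by auto
    with V0 show thesis by (rule that)
  qed
  \<comment> \<open>A symmetric neighbourhood makes the roles of \<open>K\<close> and \<open>L\<close> interchangeable.\<close>
  define V where "V = V0 \<inter> {x \<in> carrier G. inv x \<in> V0}"
  have V: "V \<in> nbhds_one" unfolding V_def using V0 nbhds_one_inv nbhds_one_inter by blast
  have Vinv: "inv x \<in> V" if "x \<in> V" for x
    using that nbhds_one_carrier[OF V0] by (auto simp: V_def)
  define P where "P f k r \<longleftrightarrow> r \<in> carrier G \<and> ((\<forall>j<k. f j \<in> carrier G) \<longrightarrow> (\<forall>K L. K \<subseteq> {..<k} \<longrightarrow> L \<subseteq> {..<k} \<longrightarrow>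
      (finprod G f K \<otimes> inv (finprod G f L)) \<otimes> inv r \<notin> V))" for f :: "nat \<Rightarrow> 'a" and k r
  have "\<exists>a. \<forall>k. P a k (a k)"
  proof (rule dependent_wellorder_choice)
    fix r :: 'a and f g :: "nat \<Rightarrow> 'a" and k :: nat
    assume eq: "\<And>j. j < k \<Longrightarrow> f j = g j"
    have "finprod G f K = finprod G g K" if "K \<subseteq> {..<k}" "\<forall>j<k. g j \<in> carrier G" for K
      by (rule finprod_cong') (use that eq in auto)
    moreover have "(\<forall>j<k. f j \<in> carrier G) \<longleftrightarrow> (\<forall>j<k. g j \<in> carrier G)" using eq by auto
    ultimately show "P f k r = P g k r" unfolding P_def by auto
  next
    fix k f assume "\<And>j. j < k \<Longrightarrow> P f j (f j)"
    then have car: "f j \<in> carrier G" if "j < k" for j using that by (simp add: P_def)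
    define C where "C = (\<lambda>(K, L). finprod G f K \<otimes> inv (finprod G f L)) ` (Pow {..<k} \<times> Pow {..<k})"
    have "finprod G f K \<in> carrier G" if "K \<subseteq> {..<k}" for K
      by (rule finprod_closed) (use that car in auto)
    then have "C \<subseteq> carrier G" by (auto simp: C_def)
    moreover have "finite C" by (simp add: C_def)
    ultimately obtain x where "x \<in> carrier G" "\<forall>c\<in>C. c \<otimes> inv x \<notin> V0" using unbdd by blast
    then have "P f k x" unfolding P_def C_def V_def by force
    then show "\<exists>r. P f k r" ..
  qed
  then obtain a where a: "\<And>k. P a k (a k)" by blast
  have ac: "a k \<in> carrier G" for k using a[of k] by (simp add: P_def)
  then have fp: "finprod G a K \<in> carrier G" for K by (intro finprod_closed) auto
  have far: "finprod G a K \<otimes> inv (finprod G a L) \<notin> V" if k: "k \<in> L" "k \<notin> K"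
     "finite K" "finite L" "\<And>j. k < j \<Longrightarrow> j \<in> K \<longleftrightarrow> j \<in> L" for K L k
  proof -
    define J where "J = K \<inter> {k<..}"
    define K' where "K' = K \<inter> {..<k}"
    define L' where "L' = L \<inter> {..<k}"
    have fin: "finite J" "finite K'" "finite L'" using k by (auto simp: J_def K'_def L'_def)
    have tri: "j \<in> {..<k} \<or> j = k \<or> j \<in> {k<..}" for j by auto
    have top: "J = L \<inter> {k<..}" using k(5) by (auto simp: J_def)
    have "K = K' \<union> J" unfolding J_def K'_def using k(2) tri by blast
    moreover have "K' \<inter> J = {}" by (auto simp: J_def K'_def)
    ultimately have K: "finprod G a K = finprod G a K' \<otimes> finprod G a J"
      using fin ac by (simp add: finprod_Un_disjoint)
    have "L = insert k (L' \<union> J)" unfolding top L'_def using k(1) tri by blast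
    moreover have "L' \<inter> J = {}" "k \<notin> L' \<union> J" by (auto simp: J_def L'_def)
    ultimately have L: "finprod G a L = a k \<otimes> (finprod G a L' \<otimes> finprod G a J)"
      using fin ac by (simp add: finprod_Un_disjoint)
    have "finprod G a K \<otimes> inv (finprod G a L) = (finprod G a K' \<otimes> inv (finprod G a L')) \<otimes> inv (a k)"
      unfolding K L using fp ac by (intro mult_div_mult_cancel) auto
    then show ?thesis using a[of k] ac by (auto simp: P_def K'_def L'_def)
  qed
  show ?thesis
  proof
    fix K L :: "nat set" assume KL: "finite K" "finite L" "K \<noteq> L"
    \<comment> \<open>The factors above the largest index of the symmetric difference cancel; that index decides.\<close>
    define D where "D = (K - L) \<union> (L - K)"
    have D: "finite D" "D \<noteq> {}" using KL by (auto simp: D_def)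
    have top: "j \<in> K \<longleftrightarrow> j \<in> L" if "Max D < j" for j
      using that D Max_ge[OF D(1), of j] by (auto simp: D_def)
    from Max_in[OF D] consider "Max D \<in> L" "Max D \<notin> K" | "Max D \<in> K" "Max D \<notin> L"
      by (auto simp: D_def)
    then show "finprod G a K \<otimes> inv (finprod G a L) \<notin> V"
    proof cases
      case 1 then show ?thesis using far KL top by blast
    next
      case 2
      then have "finprod G a L \<otimes> inv (finprod G a K) \<notin> V" using far KL top by blast
      moreover have "finprod G a L \<otimes> inv (finprod G a K) = inv (finprod G a K \<otimes> inv (finprod G a L))"
        using fp by (simp add: inv_mult m_comm)
      ultimately show ?thesis using Vinv by metis
    qed
  qed (use V ac in auto)
qed

end

lemma e_sTG_closedD:
  fixes Y :: "'b monoid"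
  assumes "e_sTG_closed TYPE('b) G T" "semitopological_group Y S" "Hausdorff_space S"
    "f \<in> hom G Y" "embedding_map T S f"
  shows "closedin S (f ` carrier G)"
  using assms by (simp add: e_sTG_closed_def)

context abelian_topological_group begin

text \<open>
  This is the finest translation-invariant topology on \<open>G \<times> \<int>\<close> for which the inclusions of
  \<open>G\<close> as the levels are continuous and \<open>(a k, 1)\<close> converges to the unit. Taking the finest one makes
  it as easy as possible to separate points; joint continuity of the multiplication is given up.
\<close>

definition limit_topology :: "(nat \<Rightarrow> 'a) \<Rightarrow> ('a \<times> int) topology" where
  "limit_topology a = topology (\<lambda>U. U \<subseteq> carrier G \<times> UNIV \<and> (\<forall>n. openin T {x. (x, n) \<in> U}) \<and>
     (\<forall>x n. (x, n) \<in> U \<longrightarrow> (\<forall>\<^sub>F k in sequentially. (x \<otimes> a k, n + 1) \<in> U)))"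

lemma openin_limit_topology:
  "openin (limit_topology a) U \<longleftrightarrow>
     U \<subseteq> carrier G \<times> UNIV \<and> (\<forall>n. openin T {x. (x, n) \<in> U}) \<and>
     (\<forall>x n. (x, n) \<in> U \<longrightarrow> (\<forall>\<^sub>F k in sequentially. (x \<otimes> a k, n + 1) \<in> U))"
proof -
  define P where "P U \<longleftrightarrow> U \<subseteq> carrier G \<times> (UNIV :: int set) \<and> (\<forall>n. openin T {x. (x, n) \<in> U}) \<and>
     (\<forall>x n. (x, n) \<in> U \<longrightarrow> (\<forall>\<^sub>F k in sequentially. (x \<otimes> a k, n + 1) \<in> U))" for U
  have "P (U \<inter> V)" if "P U" "P V" for U V
    unfolding P_def
  proof (intro conjI allI impI)
    fix n
    have "{x. (x, n) \<in> U \<inter> V} = {x. (x, n) \<in> U} \<inter> {x. (x, n) \<in> V}" by auto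
    then show "openin T {x. (x, n) \<in> U \<inter> V}" using that by (auto simp: P_def)
  next
    fix x n assume "(x, n) \<in> U \<inter> V"
    then have "\<forall>\<^sub>F k in sequentially. (x \<otimes> a k, n + 1) \<in> U"
      "\<forall>\<^sub>F k in sequentially. (x \<otimes> a k, n + 1) \<in> V" using that by (auto simp: P_def)
    then show "\<forall>\<^sub>F k in sequentially. (x \<otimes> a k, n + 1) \<in> U \<inter> V"
      by eventually_elim simp
  qed (use that in \<open>auto simp: P_def\<close>)
  moreover have "P (\<Union>\<U>)" if "\<forall>U\<in>\<U>. P U" for \<U>
    unfolding P_def
  proof (intro conjI allI impI)
    fix n
    have "{x. (x, n) \<in> \<Union>\<U>} = (\<Union>U\<in>\<U>. {x. (x, n) \<in> U})" by auto
    moreover have "openin T (\<Union>U\<in>\<U>. {x. (x, n) \<in> U})" using that by (auto simp: P_def)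
    ultimately show "openin T {x. (x, n) \<in> \<Union>\<U>}" by simp
  next
    fix x n assume "(x, n) \<in> \<Union>\<U>"
    then obtain U where U: "U \<in> \<U>" "(x, n) \<in> U" by blast
    then have "\<forall>\<^sub>F k in sequentially. (x \<otimes> a k, n + 1) \<in> U" using that by (auto simp: P_def)
    then show "\<forall>\<^sub>F k in sequentially. (x \<otimes> a k, n + 1) \<in> \<Union>\<U>"
      by eventually_elim (use U in blast)
  qed (use that in \<open>auto simp: P_def\<close>)
  ultimately have "istopology P" by (simp add: istopology_def)
  moreover have "limit_topology a = topology P"
    unfolding limit_topology_def P_def ..
  ultimately show ?thesis by (simp add: topology_inverse' P_def)
qed

lemma topspace_limit_topology:
  assumes "\<And>k. a k \<in> carrier G"
  shows "topspace (limit_topology a) = carrier G \<times> UNIV"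
proof -
  have "openin (limit_topology a) (carrier G \<times> UNIV)"
    unfolding openin_limit_topology using assms topspace_eq openin_topspace[of T] by auto
  moreover have "U \<subseteq> carrier G \<times> UNIV" if "openin (limit_topology a) U" for U
    using that unfolding openin_limit_topology by blast
  ultimately show ?thesis unfolding topspace_def by blast
qed

lemma semitopological_group_limit_topology:
  assumes a: "\<And>k. a k \<in> carrier G"
  shows "semitopological_group (G \<times>\<times> integer_group) (limit_topology a)"
proof (intro semitopological_group.intro semitopological_group_axioms.intro)
  let ?Y = "G \<times>\<times> integer_group"
  show Y: "group ?Y" by (intro DirProd_group) auto
  show "topspace (limit_topology a) = carrier ?Y"
    using topspace_limit_topology[OF a] by simp
  have right: "continuous_map (limit_topology a) (limit_topology a) (\<lambda>y. y \<otimes>\<^bsub>?Y\<^esub> c)"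
    if c: "c \<in> carrier ?Y" for c
    unfolding continuous_map_def
  proof (intro conjI allI impI)
    obtain g m where gm: "c = (g, m)" "g \<in> carrier G" using c by auto
    show "(\<lambda>y. y \<otimes>\<^bsub>?Y\<^esub> c) \<in> topspace (limit_topology a) \<rightarrow> topspace (limit_topology a)"
      using gm by (auto simp: topspace_limit_topology[OF a])
    fix U assume U: "openin (limit_topology a) U"
    let ?W = "{y \<in> topspace (limit_topology a). y \<otimes>\<^bsub>?Y\<^esub> c \<in> U}"
    show "openin (limit_topology a) ?W"
      unfolding openin_limit_topology[of a ?W]
    proof (intro conjI allI impI)
      show "?W \<subseteq> carrier G \<times> UNIV" using topspace_limit_topology[OF a] by auto
      fix n
      have "{x. (x, n) \<in> ?W} = {x \<in> carrier G. g \<otimes> x \<in> {z. (z, n + m) \<in> U}}"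
        using gm by (auto simp: topspace_limit_topology[OF a] m_comm)
      then show "openin T {x. (x, n) \<in> ?W}"
        using openin_translation_vimage[OF gm(2), of "{z. (z, n + m) \<in> U}"] U
        by (simp add: openin_limit_topology)
    next
      fix x n assume "(x, n) \<in> ?W"
      then have x: "x \<in> carrier G" "(x \<otimes> g, n + m) \<in> U"
        using gm by (auto simp: topspace_limit_topology[OF a])
      then have "\<forall>\<^sub>F k in sequentially. (x \<otimes> g \<otimes> a k, n + m + 1) \<in> U"
        using U by (auto simp: openin_limit_topology)
      then show "\<forall>\<^sub>F k in sequentially. (x \<otimes> a k, n + 1) \<in> ?W"
      proof eventually_elim
        case (elim k)
        moreover have "x \<otimes> g \<otimes> a k = x \<otimes> a k \<otimes> g" using x gm a by (simp add: m_ac)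
        ultimately show ?case
          using x gm a by (simp add: topspace_limit_topology[OF a] algebra_simps)
      qed
    qed
  qed
  then show "c \<in> carrier ?Y \<Longrightarrow> continuous_map (limit_topology a) (limit_topology a) (\<lambda>y. y \<otimes>\<^bsub>?Y\<^esub> c)" for c .
  show "continuous_map (limit_topology a) (limit_topology a) (\<lambda>y. c \<otimes>\<^bsub>?Y\<^esub> y)"
    if c: "c \<in> carrier ?Y" for c
  proof (rule continuous_map_eq[OF right[OF c]])
    show "y \<otimes>\<^bsub>?Y\<^esub> c = c \<otimes>\<^bsub>?Y\<^esub> y" if "y \<in> topspace (limit_topology a)" for y
      using that c by (auto simp: topspace_limit_topology[OF a] m_comm)
  qed
qed

text \<open>
  Starting from \<open>U\<close> on level \<open>n\<close>, a set that is open for the limit topology must contain almost all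
  products with the terms of the sequence, and so on level by level. Using every index at most once,
  and only indices from \<open>j\<close> on, meets this demand by products over finite sets of indices.
\<close>

definition fan :: "(nat \<Rightarrow> 'a) \<Rightarrow> nat \<Rightarrow> 'a set \<Rightarrow> int \<Rightarrow> ('a \<times> int) set" where
  "fan a j U n = {(u \<otimes> finprod G a K, n + int (card K)) | u K. u \<in> U \<and> finite K \<and> K \<subseteq> {j..}}"

text \<open>
  A point that was reached by the index set \<open>K\<close> may be followed by any index beyond \<open>K\<close>, which excludes
  only finitely many.
\<close>

lemma openin_fan:
  assumes a: "\<And>k. a k \<in> carrier G" and U: "openin T U"
  shows "openin (limit_topology a) (fan a j U n)"
  unfolding openin_limit_topology
proof (intro conjI allI impI)
  have fp: "finprod G a K \<in> carrier G" for K using a by (intro finprod_closed) auto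
  have Uc: "U \<subseteq> carrier G" by (rule openin_carrier[OF U])
  then show "fan a j U n \<subseteq> carrier G \<times> UNIV" using fp by (auto simp: fan_def)
  fix m
  have "{x. (x, m) \<in> fan a j U n} =
      (\<Union>K\<in>{K. finite K \<and> K \<subseteq> {j..} \<and> m = n + int (card K)}. (\<lambda>u. finprod G a K \<otimes> u) ` U)"
    using fp Uc by (auto simp: fan_def image_iff m_comm subset_iff)
  also have "openin T \<dots>" using openin_translation[OF fp U] by blast
  finally show "openin T {x. (x, m) \<in> fan a j U n}" .
next
  fix x m assume "(x, m) \<in> fan a j U n"
  then obtain u K where uK: "x = u \<otimes> finprod G a K" "m = n + int (card K)"
    "u \<in> U" "finite K" "K \<subseteq> {j..}" by (auto simp: fan_def)
  obtain N where N: "K \<subseteq> {..<N}" using finite_nat_bounded[OF uK(4)] by blast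
  show "\<forall>\<^sub>F k in sequentially. (x \<otimes> a k, m + 1) \<in> fan a j U n"
    using eventually_ge_at_top[of "max N j"]
  proof eventually_elim
    case (elim k)
    then have k: "k \<notin> K" "insert k K \<subseteq> {j..}" using N uK(5) by auto
    have "u \<in> carrier G" using openin_carrier[OF U] uK(3) by blast
    moreover have "finprod G a K \<in> carrier G" using a by (intro finprod_closed) auto
    ultimately have "x \<otimes> a k = u \<otimes> finprod G a (insert k K)"
      using k uK(4) a by (simp add: uK(1) m_ac)
    moreover have "m + 1 = n + int (card (insert k K))" using k uK by simp
    ultimately show ?case unfolding fan_def using uK(3,4) k(2) by blast
  qed
qed

text \<open>
  Two fans that meet give an equation between products of terms of the sequence, up to the quotient \<open>d\<close>
  of their apexes and small factors. Freeness excludes this as soon as the indices start late enough,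
  where the bound depends on \<open>d\<close>.
\<close>

lemma Hausdorff_limit_topology:
  assumes Haus: "Hausdorff_space T"
    and a: "\<And>k. a k \<in> carrier G" and V: "V \<in> nbhds_one"
    and free: "\<And>K L. \<lbrakk>finite K; finite L; K \<noteq> L\<rbrakk> \<Longrightarrow> finprod G a K \<otimes> inv (finprod G a L) \<notin> V"
  shows "Hausdorff_space (limit_topology a)"
proof -
  have fp: "finprod G a K \<in> carrier G" for K using a by (intro finprod_closed) auto
  obtain W1 where W1: "W1 \<in> nbhds_one" "\<And>v w. v \<in> W1 \<Longrightarrow> w \<in> W1 \<Longrightarrow> v \<otimes> inv w \<in> V"
    using nbhds_one_div[OF V] by metis
  obtain W where W: "W \<in> nbhds_one" "\<And>v w. v \<in> W \<Longrightarrow> w \<in> W \<Longrightarrow> v \<otimes> inv w \<in> W1"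
    using nbhds_one_div[OF W1(1)] by metis
  have Wc: "W \<subseteq> carrier G" by (rule nbhds_one_carrier[OF W(1)])
  \<comment> \<open>The fans with indices from \<open>j\<close> on at two points with quotient \<open>d\<close> can meet through
    different index sets only if
    \<open>d\<close> has a representation as below by index sets beyond \<open>j\<close>.\<close>
  define bad where "bad d K L \<longleftrightarrow> finite K \<and> finite L \<and> K \<noteq> L \<and>
     (\<exists>v\<in>W. \<exists>w\<in>W. d = (finprod G a K \<otimes> inv (finprod G a L)) \<otimes> (v \<otimes> inv w))" for d K L
  \<comment> \<open>Two such representations of the same \<open>d\<close> over disjoint blocks of indices would divide out to a
    nontrivial quotient of finite products inside \<open>V\<close>; so they stop from some index on.\<close>
  have tail: "\<exists>j. \<forall>K\<subseteq>{j..}. \<forall>L\<subseteq>{j..}. \<not> bad d K L" if d: "d \<in> carrier G" for d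
  proof (rule ccontr)
    assume "\<nexists>j. \<forall>K\<subseteq>{j..}. \<forall>L\<subseteq>{j..}. \<not> bad d K L"
    then have ex: "\<exists>K\<subseteq>{j..}. \<exists>L\<subseteq>{j..}. bad d K L" for j by blast
    obtain K L where KL: "bad d K L" using ex[of 0] by blast
    then have "finite (K \<union> L)" by (auto simp: bad_def)
    then obtain N where N: "K \<union> L \<subseteq> {..<N}" using finite_nat_bounded by blast
    obtain K' L' where KL': "K' \<subseteq> {N..}" "L' \<subseteq> {N..}" "bad d K' L'" using ex by blast
    obtain v w where vw: "v \<in> W" "w \<in> W" "d = (finprod G a K \<otimes> inv (finprod G a L)) \<otimes> (v \<otimes> inv w)"
      using KL by (auto simp: bad_def)
    obtain v' w' where vw': "v' \<in> W" "w' \<in> W" "d = (finprod G a K' \<otimes> inv (finprod G a L')) \<otimes> (v' \<otimes> inv w')"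
      using KL' by (auto simp: bad_def)
    have fin: "finite K" "finite L" "finite K'" "finite L'" "K \<noteq> L" using KL KL' by (auto simp: bad_def)
    have disj: "K \<inter> L' = {}" "L \<inter> K' = {}" using N KL' by fastforce+
    have "K \<union> L' \<noteq> L \<union> K'"
    proof
      assume "K \<union> L' = L \<union> K'"
      then have "(K \<union> L') \<inter> {..<N} = (L \<union> K') \<inter> {..<N}" by simp
      moreover have "(K \<union> L') \<inter> {..<N} = K" "(L \<union> K') \<inter> {..<N} = L" using N KL' by fastforce+
      ultimately show False using fin by simp
    qed
    then have "finprod G a (K \<union> L') \<otimes> inv (finprod G a (L \<union> K')) \<notin> V"
      using fin by (intro free) auto
    moreover have "finprod G a (K \<union> L') = finprod G a K \<otimes> finprod G a L'"
      "finprod G a (L \<union> K') = finprod G a L \<otimes> finprod G a K'"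
      using fin disj a by (simp_all add: finprod_Un_disjoint)
    moreover have "(finprod G a K \<otimes> finprod G a L') \<otimes> inv (finprod G a L \<otimes> finprod G a K')
        = (v' \<otimes> inv w') \<otimes> inv (v \<otimes> inv w)"
      using vw(3) vw'(3) vw(1,2) vw'(1,2) Wc fp by (intro cross_quotient_eq) auto
    ultimately show False using W1(2) W(2) vw vw' by metis
  qed
  show ?thesis
    unfolding Hausdorff_space_def
  proof (intro allI impI, elim conjE)
    fix p q assume p: "p \<in> topspace (limit_topology a)" and q: "q \<in> topspace (limit_topology a)" and "p \<noteq> q"
    obtain x m y n where xy: "p = (x, m)" "q = (y, n)" "x \<in> carrier G" "y \<in> carrier G"
      using p q by (auto simp: topspace_limit_topology[OF a])
    let ?d = "x \<otimes> inv y"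
    have d: "?d \<in> carrier G" using xy by simp
    obtain j where j: "\<And>K L. K \<subseteq> {j..} \<Longrightarrow> L \<subseteq> {j..} \<Longrightarrow> \<not> bad ?d K L" using tail[OF d] by blast
    \<comment> \<open>\<open>W\<close> only handles different index sets; equal ones cancel, and then \<open>x\<close> and \<open>y\<close> have to be
      separated in \<open>T\<close> itself.\<close>
    obtain W' where W': "W' \<in> nbhds_one" "x \<noteq> y \<Longrightarrow> (\<forall>v\<in>W'. \<forall>w\<in>W'. v \<otimes> inv w \<noteq> ?d)"
    proof (cases "x = y")
      case True
      then show thesis using that W(1) by blast
    next
      case False
      then have "?d \<noteq> \<one>" using xy by (metis inv_closed inv_inv inv_equality)
      then have "topspace T - {?d} \<in> nbhds_one"
        using openin_diff[OF openin_topspace closedin_Hausdorff_singleton[OF Haus]] d topspace_eq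
        by (auto simp: nbhds_one_def)
      then obtain U where "U \<in> nbhds_one" "\<And>v w. v \<in> U \<Longrightarrow> w \<in> U \<Longrightarrow> v \<otimes> inv w \<in> topspace T - {?d}"
        by (rule nbhds_one_div) blast
      then show thesis using that by blast
    qed
    define X where "X = W \<inter> W'"
    have X: "X \<in> nbhds_one" "X \<subseteq> carrier G" "X \<subseteq> W" "X \<subseteq> W'"
      using W(1) W'(1) nbhds_one_inter nbhds_one_carrier by (auto simp: X_def)
    define U where "U z = (\<lambda>v. z \<otimes> v) ` X" for z
    have opn: "openin (limit_topology a) (fan a j (U z) i)" if "z \<in> carrier G" for z i
      using openin_fan[OF a openin_translation[OF that]] X(1) by (auto simp: U_def nbhds_one_def)
    have mem: "(z, i) \<in> fan a j (U z) i" if "z \<in> carrier G" for z i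
    proof -
      have "z \<in> U z" using X(1) that by (auto simp: U_def nbhds_one_def image_iff intro!: bexI[of _ \<one>])
      then show ?thesis using that unfolding fan_def by (auto intro!: exI[of _ z] exI[of _ "{}"])
    qed
    have "disjnt (fan a j (U x) m) (fan a j (U y) n)"
      unfolding disjnt_def
    proof (rule ccontr)
      assume "fan a j (U x) m \<inter> fan a j (U y) n \<noteq> {}"
      then obtain r where "r \<in> fan a j (U x) m" "r \<in> fan a j (U y) n" by blast
      then obtain v w K L where vw: "v \<in> X" "w \<in> X" and KL: "finite K" "finite L" "K \<subseteq> {j..}" "L \<subseteq> {j..}"
        and eq: "(x \<otimes> v) \<otimes> finprod G a K = (y \<otimes> w) \<otimes> finprod G a L" "m + int (card K) = n + int (card L)"
        unfolding fan_def U_def by auto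
      have d_eq: "?d = (finprod G a L \<otimes> inv (finprod G a K)) \<otimes> (w \<otimes> inv v)"
        using eq(1) xy vw X(2) fp by (intro quotient_eq_of_cancelled_products) auto
      show False
      proof (cases "K = L")
        case True
        then have "?d = w \<otimes> inv v" using d_eq vw X(2) fp by (auto simp: subset_iff)
        moreover have "x \<noteq> y" using True eq(2) \<open>p \<noteq> q\<close> xy by auto
        then have *: "\<forall>v\<in>W'. \<forall>w\<in>W'. v \<otimes> inv w \<noteq> ?d" by (rule W'(2))
        have "v \<in> W'" "w \<in> W'" using vw X(4) by auto
        then have "w \<otimes> inv v \<noteq> ?d" using * by blast
        ultimately show False by simp
      next
        case False
        then have "bad ?d L K" using d_eq KL vw X(3) unfolding bad_def by blast
        then show False using j KL by blast
      qed
    qed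
    then show "\<exists>A B. openin (limit_topology a) A \<and> openin (limit_topology a) B \<and> p \<in> A \<and> q \<in> B \<and> disjnt A B"
      using opn[OF xy(3)] opn[OF xy(4)] mem[OF xy(3)] mem[OF xy(4)] unfolding xy(1,2)
      by (intro exI[of _ "fan a j (U x) m"] exI[of _ "fan a j (U y) n"]) simp
  qed
qed

lemma embedding_limit_topology:
  assumes Haus: "Hausdorff_space T" and a: "\<And>k. a k \<in> carrier G"
  shows "embedding_map T (limit_topology a) (\<lambda>x. (x, 0))"
proof (rule embedding_mapI_separating_opens[OF Haus])
  show "continuous_map T (limit_topology a) (\<lambda>x. (x, 0))"
    unfolding continuous_map_def
  proof (intro conjI allI impI)
    show "(\<lambda>x. (x, 0)) \<in> topspace T \<rightarrow> topspace (limit_topology a)"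
      using topspace_limit_topology[OF a] topspace_eq by auto
    fix U assume "openin (limit_topology a) U"
    then have "openin T (topspace T \<inter> {x. (x, 0) \<in> U})" by (auto simp: openin_limit_topology)
    then show "openin T {x \<in> topspace T. (x, 0) \<in> U}" by (simp add: Int_def)
  qed
next
  fix U assume U: "openin T U"
  \<comment> \<open>Above level 0 everything has to be included, because limits are approached from higher levels;
    below it nothing has to be.\<close>
  let ?V = "{(x, n). x \<in> carrier G \<and> (0 < n \<or> n = (0 :: int) \<and> x \<in> U)}"
  have "openin T {x. (x, n) \<in> ?V}" for n
  proof -
    have "{x. (x, n) \<in> ?V} = (if n < 0 then {} else if n = 0 then U else carrier G)"
      using openin_carrier[OF U] by auto
    then show ?thesis using U openin_topspace[of T] topspace_eq by simp
  qed
  then have "openin (limit_topology a) ?V"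
    unfolding openin_limit_topology using a by auto
  then show "\<exists>V. openin (limit_topology a) V \<and> (\<forall>x\<in>topspace T. (x, 0) \<in> V \<longleftrightarrow> x \<in> U)"
    using topspace_eq by (intro exI[of _ ?V]) auto
qed

proposition e_sTG_closed_imp_totally_bounded:
  assumes Haus: "Hausdorff_space T" and closed: "e_sTG_closed TYPE('a \<times> int) G T"
  shows totally_bounded
proof (rule ccontr)
  assume "\<not> totally_bounded"
  then obtain V a where V: "V \<in> nbhds_one" and a: "\<And>k::nat. a k \<in> carrier G"
    and free: "\<And>K L. \<lbrakk>finite K; finite L; K \<noteq> L\<rbrakk> \<Longrightarrow> finprod G a K \<otimes> inv (finprod G a L) \<notin> V"
    using not_totally_bounded_free_sequence by metis
  let ?f = "\<lambda>x. (x, 0 :: int)" and ?S = "limit_topology a"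
  have hom: "?f \<in> hom G (G \<times>\<times> integer_group)" by (auto simp: hom_def)
  have "closedin ?S (?f ` carrier G)"
    by (rule e_sTG_closedD[OF closed semitopological_group_limit_topology[OF a]
          Hausdorff_limit_topology[OF Haus a V free] hom embedding_limit_topology[OF Haus a]])
  then have "openin ?S (topspace ?S - ?f ` carrier G)" (is "openin _ ?C") by blast
  \<comment> \<open>The points \<open>(a k, 0)\<close> of the copy of \<open>G\<close> converge to \<open>(\<one>, - 1)\<close>.\<close>
  moreover have "(\<one>, -1) \<in> ?C" using topspace_limit_topology[OF a] by auto
  ultimately have "\<forall>\<^sub>F k in sequentially. (\<one> \<otimes> a k, - 1 + 1) \<in> ?C"
    unfolding openin_limit_topology by blast
  then obtain k where "(\<one> \<otimes> a k, - 1 + 1) \<in> ?C" using eventually_happens' sequentially_bot by blast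
  then show False using a by auto
qed

end

section \<open>Hausdorff quotients from neighbourhood bases\<close>

text \<open>
  A filter base of sets that behaves like the neighbourhoods of the unit in an abelian topological group,
  apart from separation. Dividing by the intersection of the base gives a Hausdorff group.
\<close>

locale group_nbhd_base = comm_group P for P :: "('p, 'm) monoid_scheme" (structure) +
  fixes B :: "'p set set"
  assumes base_nonempty: "B \<noteq> {}"
    and base_carrier: "V \<in> B \<Longrightarrow> V \<subseteq> carrier P"
    and base_one: "V \<in> B \<Longrightarrow> \<one> \<in> V"
    and base_inter: "V \<in> B \<Longrightarrow> W \<in> B \<Longrightarrow> \<exists>U\<in>B. U \<subseteq> V \<inter> W"
    and base_div: "V \<in> B \<Longrightarrow> \<exists>W\<in>B. \<forall>v\<in>W. \<forall>w\<in>W. v \<otimes> inv w \<in> V"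
begin

definition core :: "'p set" where "core = \<Inter>B"

abbreviation coset :: "'p \<Rightarrow> 'p set" where "coset p \<equiv> core #> p"

text \<open>
  Openness is tested on all representatives of a coset, which makes the quotient topology manageable
  without first introducing a topology on \<open>P\<close>.
\<close>

definition quotient_topology :: "'p set topology" where
  "quotient_topology = topology (\<lambda>\<U>. \<U> \<subseteq> carrier (P Mod core) \<and>
     (\<forall>p\<in>carrier P. coset p \<in> \<U> \<longrightarrow> (\<exists>V\<in>B. \<forall>v\<in>V. coset (p \<otimes> v) \<in> \<U>)))"

lemma openin_quotient_topology:
  "openin quotient_topology \<U> \<longleftrightarrow> \<U> \<subseteq> carrier (P Mod core) \<and>
     (\<forall>p\<in>carrier P. coset p \<in> \<U> \<longrightarrow> (\<exists>V\<in>B. \<forall>v\<in>V. coset (p \<otimes> v) \<in> \<U>))"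
proof -
  define Q where "Q \<U> \<longleftrightarrow> \<U> \<subseteq> carrier (P Mod core) \<and>
     (\<forall>p\<in>carrier P. coset p \<in> \<U> \<longrightarrow> (\<exists>V\<in>B. \<forall>v\<in>V. coset (p \<otimes> v) \<in> \<U>))" for \<U>
  have "Q (\<U> \<inter> \<V>)" if QQ: "Q \<U>" "Q \<V>" for \<U> \<V>
    unfolding Q_def
  proof (intro conjI ballI impI)
    fix p assume p: "p \<in> carrier P" "coset p \<in> \<U> \<inter> \<V>"
    obtain V where V: "V \<in> B" "\<forall>v\<in>V. coset (p \<otimes> v) \<in> \<U>" using QQ(1) p by (auto simp: Q_def)
    obtain W where W: "W \<in> B" "\<forall>v\<in>W. coset (p \<otimes> v) \<in> \<V>" using QQ(2) p by (auto simp: Q_def)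
    obtain U where "U \<in> B" "U \<subseteq> V \<inter> W" using base_inter[OF V(1) W(1)] by blast
    then show "\<exists>V\<in>B. \<forall>v\<in>V. coset (p \<otimes> v) \<in> \<U> \<inter> \<V>" using V W by blast
  qed (use QQ in \<open>auto simp: Q_def\<close>)
  moreover have "Q (\<Union>\<K>)" if QK: "\<forall>\<U>\<in>\<K>. Q \<U>" for \<K>
    unfolding Q_def
  proof (intro conjI ballI impI)
    fix p assume p: "p \<in> carrier P" "coset p \<in> \<Union>\<K>"
    then obtain \<U> where U: "\<U> \<in> \<K>" "coset p \<in> \<U>" by blast
    then have "Q \<U>" using QK by blast
    then obtain V where "V \<in> B" "\<forall>v\<in>V. coset (p \<otimes> v) \<in> \<U>" using U p by (auto simp: Q_def)
    then show "\<exists>V\<in>B. \<forall>v\<in>V. coset (p \<otimes> v) \<in> \<Union>\<K>" using U by blast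
  qed (use QK in \<open>auto simp: Q_def\<close>)
  ultimately have "istopology Q" by (simp add: istopology_def)
  moreover have "quotient_topology = topology Q"
    unfolding quotient_topology_def Q_def ..
  ultimately show ?thesis by (simp add: topology_inverse' Q_def)
qed

lemma topspace_quotient_topology: "topspace quotient_topology = carrier (P Mod core)"
proof -
  obtain V where V: "V \<in> B" using base_nonempty by blast
  have "coset (p \<otimes> v) \<in> carrier (P Mod core)" if "p \<in> carrier P" "v \<in> V" for p v
    using that base_carrier[OF V] by (auto simp: carrier_FactGroup)
  then have "openin quotient_topology (carrier (P Mod core))"
    unfolding openin_quotient_topology using V by blast
  moreover have "\<U> \<subseteq> carrier (P Mod core)" if "openin quotient_topology \<U>" for \<U>
    using that openin_quotient_topology by blast
  ultimately show ?thesis by (metis openin_subset openin_topspace subset_antisym)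
qed

lemma subgroup_core: "subgroup core P"
proof (rule subgroupI)
  obtain V where "V \<in> B" using base_nonempty by blast
  then show sub: "core \<subseteq> carrier P" using base_carrier by (auto simp: core_def)
  have one: "\<one> \<in> core" using base_one by (auto simp: core_def)
  then show "core \<noteq> {}" by blast
  have div: "a \<otimes> inv b \<in> core" if "a \<in> core" "b \<in> core" for a b
    unfolding core_def
  proof
    fix V assume "V \<in> B"
    then obtain W where "W \<in> B" "\<forall>v\<in>W. \<forall>w\<in>W. v \<otimes> inv w \<in> V" using base_div by blast
    then show "a \<otimes> inv b \<in> V" using that by (auto simp: core_def)
  qed
  show iv: "inv b \<in> core" if "b \<in> core" for b
    using div[OF one that] that sub by auto
  show "a \<otimes> b \<in> core" if "a \<in> core" "b \<in> core" for a b
    using div[OF that(1) iv[OF that(2)]] that sub by auto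
qed

lemma normal_core: "core \<lhd> P"
  using subgroup_core by (rule subgroup_imp_normal)

lemma coset_eq_iff:
  assumes "p \<in> carrier P" "q \<in> carrier P"
  shows "coset p = coset q \<longleftrightarrow> p \<otimes> inv q \<in> core"
proof -
  interpret subgroup core P by (rule subgroup_core)
  have "coset p = coset q \<longleftrightarrow> p \<in> coset q"
    using assms repr_independence[OF _ _ subgroup_core] rcos_self[OF _ subgroup_core] by metis
  then show ?thesis using rcos_module[OF is_group assms(2,1)] by simp
qed

lemma coset_mult:
  assumes "p \<in> carrier P" "q \<in> carrier P"
  shows "coset p \<otimes>\<^bsub>P Mod core\<^esub> coset q = coset (p \<otimes> q)"
  using normal.rcos_sum[OF normal_core assms] by simp

lemma base_mult:
  assumes "V \<in> B"
  obtains W where "W \<in> B" "\<And>v w. v \<in> W \<Longrightarrow> w \<in> W \<Longrightarrow> v \<otimes> w \<in> V"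
proof -
  obtain W where W: "W \<in> B" "\<forall>v\<in>W. \<forall>w\<in>W. v \<otimes> inv w \<in> V" using base_div[OF assms] by blast
  obtain W' where W': "W' \<in> B" "\<forall>v\<in>W'. \<forall>w\<in>W'. v \<otimes> inv w \<in> W" using base_div[OF W(1)] by blast
  obtain X where X: "X \<in> B" "X \<subseteq> W \<inter> W'" using base_inter[OF W(1) W'(1)] by blast
  show thesis
  proof
    show "X \<in> B" by fact
    fix v w assume vw: "v \<in> X" "w \<in> X"
    then have w: "w \<in> carrier P" using base_carrier[OF X(1)] by blast
    have "\<one> \<otimes> inv w \<in> W" using W' X vw base_one by blast
    then have "inv w \<in> W" using w by simp
    then have "v \<otimes> inv (inv w) \<in> V" using W(2) X(2) vw(1) by blast
    then show "v \<otimes> w \<in> V" using w by simp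
  qed
qed

definition interior_cosets :: "'p set \<Rightarrow> 'p set set" where
  "interior_cosets A = {coset r | r. r \<in> carrier P \<and> (\<exists>V\<in>B. \<forall>v\<in>V. r \<otimes> v \<in> A)}"

text \<open>
  Representatives of the same coset differ by an element of \<open>core\<close>, which is absorbed by passing to a
  smaller member of the base.
\<close>

lemma interior_cosetsD:
  assumes "p \<in> carrier P" "coset p \<in> interior_cosets A"
  obtains V where "V \<in> B" "\<And>v. v \<in> V \<Longrightarrow> p \<otimes> v \<in> A"
proof -
  obtain r V where r: "r \<in> carrier P" "coset p = coset r" and V: "V \<in> B" "\<forall>v\<in>V. r \<otimes> v \<in> A"
    using assms(2) by (auto simp: interior_cosets_def)
  obtain W where W: "W \<in> B" "\<And>v w. v \<in> W \<Longrightarrow> w \<in> W \<Longrightarrow> v \<otimes> w \<in> V" using base_mult[OF V(1)] by metis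
  have "r \<otimes> inv p \<in> core" using coset_eq_iff[of r p] r assms by simp
  then have "inv (r \<otimes> inv p) \<in> core" by (rule subgroup.m_inv_closed[OF subgroup_core])
  moreover have "inv (r \<otimes> inv p) = p \<otimes> inv r" using r assms by (simp add: inv_mult m_comm)
  ultimately have pr: "p \<otimes> inv r \<in> core" by simp
  show ?thesis
  proof
    show "W \<in> B" by fact
    fix v assume v: "v \<in> W"
    have vc: "v \<in> carrier P" using v base_carrier[OF W(1)] by blast
    have "(p \<otimes> inv r) \<otimes> v \<in> V" using W v pr by (auto simp: core_def)
    then have "r \<otimes> ((p \<otimes> inv r) \<otimes> v) \<in> A" using V by simp
    moreover have "r \<otimes> ((p \<otimes> s) \<otimes> v) = (r \<otimes> s) \<otimes> (p \<otimes> v)" if "s \<in> carrier P" for s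
      using r assms vc that by (simp add: m_ac)
    from this[of "inv r"] have "r \<otimes> ((p \<otimes> inv r) \<otimes> v) = p \<otimes> v" using r assms vc by simp
    ultimately show "p \<otimes> v \<in> A" by simp
  qed
qed

lemma interior_cosetsI:
  assumes "p \<in> carrier P" "V \<in> B" "\<And>v. v \<in> V \<Longrightarrow> p \<otimes> v \<in> A"
  shows "coset p \<in> interior_cosets A"
  using assms unfolding interior_cosets_def by blast

lemma interior_cosets_mem:
  assumes "p \<in> carrier P" "coset p \<in> interior_cosets A"
  shows "p \<in> A"
  using interior_cosetsD[OF assms] base_one assms(1) r_one by metis

text \<open>
  Members of the base need not be open themselves. Open sets are obtained as interiors, in the usual way
  from \<open>W W \<subseteq> V\<close>.
\<close>

lemma openin_interior_cosets: "openin quotient_topology (interior_cosets A)"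
  unfolding openin_quotient_topology
proof (intro conjI ballI impI)
  show "interior_cosets A \<subseteq> carrier (P Mod core)"
    by (auto simp: interior_cosets_def carrier_FactGroup)
  fix p assume p: "p \<in> carrier P" "coset p \<in> interior_cosets A"
  then obtain V where V: "V \<in> B" "\<And>v. v \<in> V \<Longrightarrow> p \<otimes> v \<in> A" by (rule interior_cosetsD) blast
  obtain W where W: "W \<in> B" "\<And>v w. v \<in> W \<Longrightarrow> w \<in> W \<Longrightarrow> v \<otimes> w \<in> V" using base_mult[OF V(1)] by metis
  have Wc: "W \<subseteq> carrier P" by (rule base_carrier[OF W(1)])
  have "coset (p \<otimes> v) \<in> interior_cosets A" if v: "v \<in> W" for v
  proof (rule interior_cosetsI[OF _ W(1)])
    fix w assume w: "w \<in> W"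
    have "v \<otimes> w \<in> V" using W(2) v w by blast
    then have "p \<otimes> (v \<otimes> w) \<in> A" by (rule V(2))
    then show "p \<otimes> v \<otimes> w \<in> A" using p v w Wc by (auto simp: m_assoc subset_iff)
  qed (use p v Wc in auto)
  then show "\<exists>V\<in>B. \<forall>v\<in>V. coset (p \<otimes> v) \<in> interior_cosets A" using W(1) by blast
qed

lemma Hausdorff_quotient_topology: "Hausdorff_space quotient_topology"
  unfolding Hausdorff_space_def
proof (intro allI impI, elim conjE)
  fix C D assume "C \<in> topspace quotient_topology" "D \<in> topspace quotient_topology" "C \<noteq> D"
  then obtain p q where p: "p \<in> carrier P" "C = coset p" and q: "q \<in> carrier P" "D = coset q"
    by (auto simp: topspace_quotient_topology carrier_FactGroup)
  then have "p \<otimes> inv q \<notin> core" using coset_eq_iff \<open>C \<noteq> D\<close> by blast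
  then obtain V where V: "V \<in> B" "p \<otimes> inv q \<notin> V" by (auto simp: core_def)
  obtain W where W: "W \<in> B" "\<forall>v\<in>W. \<forall>w\<in>W. v \<otimes> inv w \<in> V" using base_div[OF V(1)] by blast
  have Wc: "W \<subseteq> carrier P" by (rule base_carrier[OF W(1)])
  let ?A = "\<lambda>r. (\<lambda>v. r \<otimes> v) ` W"
  have "disjnt (interior_cosets (?A p)) (interior_cosets (?A q))"
    unfolding disjnt_def
  proof (rule ccontr)
    assume "interior_cosets (?A p) \<inter> interior_cosets (?A q) \<noteq> {}"
    then obtain E where E: "E \<in> interior_cosets (?A p)" "E \<in> interior_cosets (?A q)" by blast
    then obtain r where r: "r \<in> carrier P" "E = coset r" by (auto simp: interior_cosets_def)
    obtain v w where vw: "v \<in> W" "w \<in> W" "r = p \<otimes> v" "r = q \<otimes> w"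
      using interior_cosets_mem r E by blast
    have "p \<otimes> inv q = (\<one> \<otimes> inv \<one>) \<otimes> (w \<otimes> inv v)"
      using p q vw Wc by (intro quotient_eq_of_cancelled_products) auto
    also have "\<dots> = w \<otimes> inv v" using subsetD[OF Wc] vw by simp
    finally show False using V(2) W(2) vw by auto
  qed
  moreover have "C \<in> interior_cosets (?A p)" "D \<in> interior_cosets (?A q)"
    using interior_cosetsI[OF _ W(1)] p q by auto
  ultimately show "\<exists>U U'. openin quotient_topology U \<and> openin quotient_topology U' \<and>
      C \<in> U \<and> D \<in> U' \<and> disjnt U U'"
    using openin_interior_cosets by blast
qed

lemma semitopological_group_quotient: "semitopological_group (P Mod core) quotient_topology"
proof (intro semitopological_group.intro semitopological_group_axioms.intro)
  show "group (P Mod core)" by (rule normal.factorgroup_is_group[OF normal_core])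
  interpret Q: comm_group "P Mod core" by (rule abelian_FactGroup[OF subgroup_core])
  show "topspace quotient_topology = carrier (P Mod core)" by (rule topspace_quotient_topology)
  show left: "continuous_map quotient_topology quotient_topology (\<lambda>x. C \<otimes>\<^bsub>P Mod core\<^esub> x)"
    if C: "C \<in> carrier (P Mod core)" for C
    unfolding continuous_map_def
  proof (intro conjI allI impI)
    show "(\<lambda>x. C \<otimes>\<^bsub>P Mod core\<^esub> x) \<in> topspace quotient_topology \<rightarrow> topspace quotient_topology"
      using Q.m_closed[OF C] unfolding topspace_quotient_topology by blast
    obtain c where c: "c \<in> carrier P" "C = coset c" using C by (auto simp: carrier_FactGroup)
    fix \<U> assume U: "openin quotient_topology \<U>"
    have pre: "coset p \<in> {x \<in> topspace quotient_topology. C \<otimes>\<^bsub>P Mod core\<^esub> x \<in> \<U>} \<longleftrightarrow> coset (c \<otimes> p) \<in> \<U>"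
      if "p \<in> carrier P" for p
      using coset_mult[OF c(1) that] that c by (auto simp: topspace_quotient_topology carrier_FactGroup)
    show "openin quotient_topology {x \<in> topspace quotient_topology. C \<otimes>\<^bsub>P Mod core\<^esub> x \<in> \<U>}"
      unfolding openin_quotient_topology
    proof (intro conjI ballI impI)
      fix p assume p: "p \<in> carrier P"
        "coset p \<in> {x \<in> topspace quotient_topology. C \<otimes>\<^bsub>P Mod core\<^esub> x \<in> \<U>}"
      then have "coset (c \<otimes> p) \<in> \<U>" using pre by blast
      then obtain V where V: "V \<in> B" "\<forall>v\<in>V. coset (c \<otimes> p \<otimes> v) \<in> \<U>"
        using U c p unfolding openin_quotient_topology by blast
      have "coset (p \<otimes> v) \<in> {x \<in> topspace quotient_topology. C \<otimes>\<^bsub>P Mod core\<^esub> x \<in> \<U>}" if "v \<in> V" for v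
      proof -
        have "v \<in> carrier P" using that base_carrier[OF V(1)] by blast
        then have "coset (c \<otimes> (p \<otimes> v)) \<in> \<U>" "p \<otimes> v \<in> carrier P"
          using V(2) that p c by (auto simp flip: m_assoc)
        then show ?thesis using pre by blast
      qed
      then show "\<exists>V\<in>B. \<forall>v\<in>V. coset (p \<otimes> v) \<in> {x \<in> topspace quotient_topology. C \<otimes>\<^bsub>P Mod core\<^esub> x \<in> \<U>}"
        using V(1) by blast
    qed (auto simp: topspace_quotient_topology)
  qed
  show "continuous_map quotient_topology quotient_topology (\<lambda>x. x \<otimes>\<^bsub>P Mod core\<^esub> C)"
    if C: "C \<in> carrier (P Mod core)" for C
  proof (rule continuous_map_eq[OF left[OF C]])
    fix x assume "x \<in> topspace quotient_topology"
    then show "C \<otimes>\<^bsub>P Mod core\<^esub> x = x \<otimes>\<^bsub>P Mod core\<^esub> C"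
      using Q.m_comm[OF C] topspace_quotient_topology by blast
  qed
qed

end

section \<open>Adjoining the limit of a Cauchy filter\<close>

context abelian_topological_group begin

text \<open>
  The integer \<open>n\<close> stands for the \<open>n\<close>-th power of an ideal limit of \<open>F\<close>: a pair is close to the unit if
  it becomes so when an element of \<open>G\<close> that is generic for \<open>F\<close> replaces the limit.
\<close>

definition adjoined_nbhd :: "'a filter \<Rightarrow> 'a set \<Rightarrow> ('a \<times> int) set" where
  "adjoined_nbhd F V = {(x, n). x \<in> carrier G \<and> (\<forall>\<^sub>F a in F. x \<otimes> a [^] n \<in> V)}"

lemma group_nbhd_base_adjoined:
  assumes F: "\<forall>\<^sub>F a in F. a \<in> carrier G"
  shows "group_nbhd_base (G \<times>\<times> integer_group) (adjoined_nbhd F ` nbhds_one)"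
proof (intro group_nbhd_base.intro group_nbhd_base_axioms.intro)
  let ?P = "G \<times>\<times> integer_group"
  have gP: "group ?P" by (intro DirProd_group) auto
  then show "comm_group ?P"
    by (rule group.group_comm_groupI) (auto simp: m_comm)
  show "adjoined_nbhd F ` nbhds_one \<noteq> {}"
    using openin_topspace[of T] topspace_eq by (auto simp: nbhds_one_def)
  fix A assume "A \<in> adjoined_nbhd F ` nbhds_one"
  then obtain V where V: "V \<in> nbhds_one" "A = adjoined_nbhd F V" by blast
  show "A \<subseteq> carrier ?P" using V by (auto simp: adjoined_nbhd_def)
  show "\<one>\<^bsub>?P\<^esub> \<in> A" using V by (auto simp: adjoined_nbhd_def nbhds_one_def)
  obtain W where W: "W \<in> nbhds_one" "\<And>v w. v \<in> W \<Longrightarrow> w \<in> W \<Longrightarrow> v \<otimes> inv w \<in> V"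
    using nbhds_one_div[OF V(1)] by metis
  have "p \<otimes>\<^bsub>?P\<^esub> inv\<^bsub>?P\<^esub> q \<in> A" if pq: "p \<in> adjoined_nbhd F W" "q \<in> adjoined_nbhd F W" for p q
  proof -
    obtain x m y n where xy: "p = (x, m)" "q = (y, n)" by fastforce
    have c: "x \<in> carrier G" "y \<in> carrier G" and ev: "\<forall>\<^sub>F a in F. x \<otimes> a [^] m \<in> W" "\<forall>\<^sub>F a in F. y \<otimes> a [^] n \<in> W"
      using pq xy by (auto simp: adjoined_nbhd_def)
    have "\<forall>\<^sub>F a in F. (x \<otimes> inv y) \<otimes> a [^] (m - n) \<in> V"
      using F ev
    proof eventually_elim
      case (elim a)
      have "(x \<otimes> inv y) \<otimes> (b \<otimes> b') = (x \<otimes> b) \<otimes> (inv y \<otimes> b')" if "b \<in> carrier G" "b' \<in> carrier G" for b b'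
        using c that by (simp add: m_ac)
      from this[of "a [^] m" "inv (a [^] n)"]
      have "(x \<otimes> inv y) \<otimes> a [^] (m - n) = (x \<otimes> a [^] m) \<otimes> inv (y \<otimes> a [^] n)"
        using c elim by (simp add: int_pow_diff inv_mult)
      then show ?case using W(2) elim by simp
    qed
    then show ?thesis using c xy V by (simp add: adjoined_nbhd_def)
  qed
  then show "\<exists>W\<in>adjoined_nbhd F ` nbhds_one. \<forall>v\<in>W. \<forall>w\<in>W. v \<otimes>\<^bsub>?P\<^esub> inv\<^bsub>?P\<^esub> w \<in> A"
    using W(1) by blast
  fix A' assume "A' \<in> adjoined_nbhd F ` nbhds_one"
  then obtain V' where V': "V' \<in> nbhds_one" "A' = adjoined_nbhd F V'" by blast
  have "adjoined_nbhd F (V \<inter> V') \<subseteq> A \<inter> A'"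
    using V V' by (auto simp: adjoined_nbhd_def elim: eventually_mono)
  then show "\<exists>U\<in>adjoined_nbhd F ` nbhds_one. U \<subseteq> A \<inter> A'"
    using nbhds_one_inter[OF V(1) V'(1)] by blast
qed

text \<open>
  The quotient of \<open>G \<times> \<int>\<close> is the group that \<open>G\<close> generates together with the limit of \<open>F\<close> inside its
  completion. If the limit has a power in \<open>G\<close>, the division by \<open>core\<close> takes care of it.
\<close>

proposition e_sTG_closed_imp_cauchy_convergent:
  assumes Haus: "Hausdorff_space T" and closed: "e_sTG_closed TYPE(('a \<times> int) set) G T"
    and F: "F \<noteq> bot" "\<forall>\<^sub>F a in F. a \<in> carrier G" and cauchy: "cauchy_filter F"
  shows "\<exists>l. limitin T (\<lambda>a. a) l F"
proof -
  let ?P = "G \<times>\<times> integer_group"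
  interpret Q: group_nbhd_base ?P "adjoined_nbhd F ` nbhds_one"
    by (rule group_nbhd_base_adjoined[OF F(2)])
  let ?f = "\<lambda>x. Q.coset (x, 0)"
  have carf: "?f x \<in> carrier (?P Mod Q.core)" if "x \<in> carrier G" for x
    using that by (auto simp: carrier_FactGroup)
  have hom: "?f \<in> hom G (?P Mod Q.core)"
  proof (rule homI)
    fix x y assume "x \<in> carrier G" "y \<in> carrier G"
    then show "?f (x \<otimes> y) = ?f x \<otimes>\<^bsub>?P Mod Q.core\<^esub> ?f y"
      using Q.coset_mult[of "(x, 0)" "(y, 0)"] by simp
  qed (rule carf)
  have level0: "(x, 0) \<in> adjoined_nbhd F V \<longleftrightarrow> x \<in> V" if "x \<in> carrier G" for x V
    using that F(1) by (simp add: adjoined_nbhd_def)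
  have sep: "\<exists>\<V>. openin Q.quotient_topology \<V> \<and> (\<forall>x\<in>topspace T. ?f x \<in> \<V> \<longleftrightarrow> x \<in> U)"
    if U: "openin T U" for U
  proof (intro exI[of _ "Q.interior_cosets (adjoined_nbhd F U)"] conjI ballI)
    show "openin Q.quotient_topology (Q.interior_cosets (adjoined_nbhd F U))"
      by (rule Q.openin_interior_cosets)
    fix x assume "x \<in> topspace T"
    then have x: "x \<in> carrier G" using topspace_eq by simp
    show "?f x \<in> Q.interior_cosets (adjoined_nbhd F U) \<longleftrightarrow> x \<in> U"
    proof
      assume "?f x \<in> Q.interior_cosets (adjoined_nbhd F U)"
      then have "(x, 0) \<in> adjoined_nbhd F U" using Q.interior_cosets_mem x by simp
      then show "x \<in> U" using level0 x by simp
    next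
      assume "x \<in> U"
      let ?V = "{v \<in> carrier G. x \<otimes> v \<in> U}"
      have "?V \<in> nbhds_one" by (rule nbhds_one_translate[OF U \<open>x \<in> U\<close>])
      moreover have "(x, 0) \<otimes>\<^bsub>?P\<^esub> v \<in> adjoined_nbhd F U" if v: "v \<in> adjoined_nbhd F ?V" for v
      proof -
        obtain y n where y: "v = (y, n)" "y \<in> carrier G" "\<forall>\<^sub>F a in F. y \<otimes> a [^] n \<in> ?V"
          using v by (auto simp: adjoined_nbhd_def)
        have "\<forall>\<^sub>F a in F. (x \<otimes> y) \<otimes> a [^] n \<in> U"
          using F(2) y(3) by eventually_elim (use x y(2) in \<open>simp add: m_assoc\<close>)
        then show ?thesis using x y by (simp add: adjoined_nbhd_def)
      qed
      ultimately show "?f x \<in> Q.interior_cosets (adjoined_nbhd F U)"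
        using x by (intro Q.interior_cosetsI[of _ "adjoined_nbhd F ?V"]) auto
    qed
  qed
  have cont: "continuous_map T Q.quotient_topology ?f"
    unfolding continuous_map_def
  proof (intro conjI allI impI)
    show "?f \<in> topspace T \<rightarrow> topspace Q.quotient_topology"
      using carf by (simp add: topspace_eq Q.topspace_quotient_topology)
    fix \<U> assume U: "openin Q.quotient_topology \<U>"
    show "openin T {x \<in> topspace T. ?f x \<in> \<U>}"
    proof (subst openin_subopen, intro ballI)
      fix x assume "x \<in> {x \<in> topspace T. ?f x \<in> \<U>}"
      then have x: "x \<in> carrier G" "?f x \<in> \<U>" by (auto simp: topspace_eq)
      have "\<exists>V\<in>nbhds_one. \<forall>v\<in>adjoined_nbhd F V. Q.coset ((x, 0) \<otimes>\<^bsub>?P\<^esub> v) \<in> \<U>"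
        using U[unfolded Q.openin_quotient_topology, THEN conjunct2, rule_format, of "(x, 0)"] x by simp
      then obtain V where V: "V \<in> nbhds_one" "\<forall>v\<in>adjoined_nbhd F V. Q.coset ((x, 0) \<otimes>\<^bsub>?P\<^esub> v) \<in> \<U>"
        by blast
      have Vc: "V \<subseteq> carrier G" by (rule nbhds_one_carrier[OF V(1)])
      have "openin T ((\<lambda>v. x \<otimes> v) ` V)"
        using openin_translation[OF x(1)] V(1) by (simp add: nbhds_one_def)
      moreover have "x \<in> (\<lambda>v. x \<otimes> v) ` V"
        using V(1) x by (auto simp: nbhds_one_def image_iff intro!: bexI[of _ \<one>])
      moreover have "?f (x \<otimes> v) \<in> \<U>" if "v \<in> V" for v
      proof -
        have "(v, 0) \<in> adjoined_nbhd F V" using that Vc level0 by blast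
        then have "Q.coset ((x, 0) \<otimes>\<^bsub>?P\<^esub> (v, 0)) \<in> \<U>" using V(2) by blast
        then show ?thesis by simp
      qed
      ultimately show "\<exists>A. openin T A \<and> x \<in> A \<and> A \<subseteq> {x \<in> topspace T. ?f x \<in> \<U>}"
        using x Vc by (intro exI[of _ "(\<lambda>v. x \<otimes> v) ` V"]) (auto simp: topspace_eq)
    qed
  qed
  have "closedin Q.quotient_topology (?f ` carrier G)"
    by (rule e_sTG_closedD[OF closed Q.semitopological_group_quotient Q.Hausdorff_quotient_topology
          hom embedding_mapI_separating_opens[OF Haus cont sep]])
  then have opn: "openin Q.quotient_topology (topspace Q.quotient_topology - ?f ` carrier G)"
    (is "openin _ ?C") by blast
  \<comment> \<open>The class of \<open>(\<one>, 1)\<close> is the limit of \<open>F\<close>; closedness puts it into \<open>G\<close>.\<close>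
  have "Q.coset (\<one>, 1) \<in> ?f ` carrier G"
  proof (rule ccontr)
    assume "Q.coset (\<one>, 1) \<notin> ?f ` carrier G"
    then have "Q.coset (\<one>, 1) \<in> ?C" by (auto simp: Q.topspace_quotient_topology carrier_FactGroup)
    moreover have "(\<one>, 1) \<in> carrier ?P" by simp
    ultimately obtain V where V: "V \<in> nbhds_one" "\<forall>v\<in>adjoined_nbhd F V. Q.coset ((\<one>, 1) \<otimes>\<^bsub>?P\<^esub> v) \<in> ?C"
      using opn unfolding Q.openin_quotient_topology by blast
    obtain c where c: "c \<in> carrier G" "\<forall>\<^sub>F x in F. c \<otimes> inv x \<in> V"
      using cauchy V(1) unfolding cauchy_filter_def by blast
    have "\<forall>\<^sub>F x in F. c \<otimes> x [^] (- 1 :: int) \<in> V"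
      using c(2) F(2) by eventually_elim (simp add: int_pow_neg)
    then have "(c, -1) \<in> adjoined_nbhd F V" using c(1) by (simp add: adjoined_nbhd_def)
    then have "Q.coset ((\<one>, 1) \<otimes>\<^bsub>?P\<^esub> (c, -1)) \<in> ?C" using V(2) by blast
    then have "?f c \<in> ?C" using c by simp
    then show False using c by blast
  qed
  then obtain l where l: "l \<in> carrier G" "Q.coset (\<one>, 1) = Q.coset (l, 0)" by blast
  then have "(\<one>, 1) \<otimes>\<^bsub>?P\<^esub> inv\<^bsub>?P\<^esub> (l, 0) \<in> Q.core"
    using Q.coset_eq_iff[of "(\<one>, 1)" "(l, 0)"] by simp
  then have near: "(inv l, 1) \<in> adjoined_nbhd F V" if "V \<in> nbhds_one" for V
    using that l by (simp add: Q.core_def)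
  have "limitin T (\<lambda>a. a) l F"
    unfolding limitin_def
  proof (intro conjI allI impI)
    show "l \<in> topspace T" using l topspace_eq by simp
    fix U assume "openin T U \<and> l \<in> U"
    then have V: "{v \<in> carrier G. l \<otimes> v \<in> U} \<in> nbhds_one" using nbhds_one_translate by blast
    then have "\<forall>\<^sub>F a in F. inv l \<otimes> a [^] (1 :: int) \<in> {v \<in> carrier G. l \<otimes> v \<in> U}"
      using near[OF V] by (simp add: adjoined_nbhd_def)
    then show "\<forall>\<^sub>F a in F. a \<in> U"
      using F(2) by eventually_elim (use l in \<open>simp add: int_pow_1 m_assoc[symmetric]\<close>)
  qed
  then show ?thesis ..
qed

end

section \<open>Compactness from total boundedness and completeness\<close>

text \<open>
  Finer filters are smaller in the order of filters, so an ultrafilter is a minimal proper filter.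
\<close>

lemma ultrafilter_exists:
  fixes F :: "'a filter"
  assumes "F \<noteq> bot"
  obtains U where "U \<le> F" "U \<noteq> bot" "\<And>P. eventually P U \<or> eventually (\<lambda>x. \<not> P x) U"
proof -
  let ?A = "{U. U \<le> F \<and> U \<noteq> bot}"
  have "\<exists>M\<in>?A. \<forall>U\<in>?A. U \<le> M \<longrightarrow> U = M"
  proof (rule predicate_Zorn[where P = "\<lambda>U V. V \<le> U"])
    show "partial_order_on ?A (relation_of (\<lambda>U V. V \<le> U) ?A)"
      by (rule partial_order_on_relation_ofI) auto
    fix C assume C: "C \<in> Chains (relation_of (\<lambda>U V. V \<le> U) ?A)"
    then have CA: "C \<subseteq> ?A" and chain: "\<And>U V. U \<in> C \<Longrightarrow> V \<in> C \<Longrightarrow> U \<le> V \<or> V \<le> U"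
      unfolding Chains_def relation_of_def by blast+
    show "\<exists>u\<in>?A. \<forall>a\<in>C. u \<le> a"
    proof (cases "C = {}")
      case True
      then show ?thesis using assms by blast
    next
      case False
      have "Inf X \<noteq> bot" if X: "X \<subseteq> C" "finite X" for X
      proof (cases "X = {}")
        case True
        then have "F \<le> Inf X" by simp
        then show ?thesis using assms le_bot by metis
      next
        case False
        have "\<exists>m\<in>X. \<forall>U\<in>X. m \<le> U"
          using X(2) False X(1)
        proof (induction X rule: finite_ne_induct)
          case (insert U X)
          then obtain m where m: "m \<in> X" "\<forall>V\<in>X. m \<le> V" by blast
          then show ?case using chain[of U m] insert.prems by (metis insertE insertI1 insertI2 insert_subset order_trans order_refl subsetD)
        qed simp
        then obtain m where "m \<in> X" "\<forall>U\<in>X. m \<le> U" by blast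
        then have "m \<le> Inf X" "m \<noteq> bot" using Inf_greatest[of X m] X CA by auto
        then show ?thesis using bot_unique by metis
      qed
      then have "Inf C \<noteq> bot" by (rule Inf_filter_not_bot)
      moreover have "Inf C \<le> F" using False CA by (metis (no_types, lifting) Inf_lower2 ex_in_conv mem_Collect_eq subsetD)
      ultimately show ?thesis using Inf_lower[of _ C] by blast
    qed
  qed
  then obtain U where U: "U \<le> F" "U \<noteq> bot" and min: "\<And>V. V \<le> F \<Longrightarrow> V \<noteq> bot \<Longrightarrow> V \<le> U \<Longrightarrow> V = U" by blast
  show thesis
  proof
    fix P
    let ?V = "inf U (principal {x. P x})"
    show "eventually P U \<or> eventually (\<lambda>x. \<not> P x) U"
    proof (cases "?V = bot")
      case True
      then have "eventually (\<lambda>x. False) ?V" by simp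
      then show ?thesis by (simp add: eventually_inf_principal)
    next
      case False
      then have "?V = U" using min[of ?V] U(1) by (meson inf.coboundedI1 inf_le1)
      moreover have "eventually P ?V" by (simp add: eventually_inf_principal)
      ultimately have "eventually P U" by simp
      then show ?thesis ..
    qed
  qed (fact U)+
qed

context topological_group begin

text \<open>
  One of the finitely many translates that cover \<open>G\<close> belongs to the ultrafilter.
\<close>

lemma ultrafilter_cauchy:
  assumes tb: totally_bounded
    and F: "F \<noteq> bot" "\<forall>\<^sub>F a in F. a \<in> carrier G" and ultra: "\<And>P. eventually P F \<or> eventually (\<lambda>x. \<not> P x) F"
  shows "cauchy_filter F"
  unfolding cauchy_filter_def
proof
  fix V assume "V \<in> nbhds_one"
  then obtain C where C: "C \<subseteq> carrier G" "finite C" "\<forall>x\<in>carrier G. \<exists>c\<in>C. c \<otimes> inv x \<in> V"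
    using tb unfolding totally_bounded_def by blast
  have "\<exists>c\<in>C. \<forall>\<^sub>F x in F. c \<otimes> inv x \<in> V"
  proof (rule ccontr)
    assume "\<not> ?thesis"
    then have "\<forall>c\<in>C. \<forall>\<^sub>F x in F. c \<otimes> inv x \<notin> V" using ultra by blast
    then have "\<forall>\<^sub>F x in F. \<forall>c\<in>C. c \<otimes> inv x \<notin> V" using C(2) by (simp add: eventually_ball_finite)
    then have "\<forall>\<^sub>F x in F. False" using F(2) by eventually_elim (use C(3) in blast)
    then show False using F(1) by simp
  qed
  then show "\<exists>c\<in>carrier G. \<forall>\<^sub>F x in F. c \<otimes> inv x \<in> V" using C(1) by blast
qed

text \<open>
  A family of closed sets with the finite intersection property generates a filter; an ultrafilter above
  it is Cauchy by total boundedness, and its limit lies in all the sets.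
\<close>

proposition totally_bounded_complete_imp_compact:
  assumes tb: totally_bounded
    and complete: "\<And>F. F \<noteq> bot \<Longrightarrow> (\<forall>\<^sub>F a in F. a \<in> carrier G) \<Longrightarrow> cauchy_filter F \<Longrightarrow> \<exists>l. limitin T (\<lambda>a. a) l F"
  shows "compact_space T"
  unfolding compact_space_fip
proof (intro allI impI, elim conjE)
  fix \<U> assume cl: "\<forall>C\<in>\<U>. closedin T C" and fip: "\<forall>\<F>. finite \<F> \<and> \<F> \<subseteq> \<U> \<longrightarrow> \<Inter>\<F> \<noteq> {}"
  show "\<Inter>\<U> \<noteq> {}"
  proof (cases "\<U> = {}")
    case False
    have "(INF C\<in>\<U>. principal C) \<noteq> bot"
    proof (rule INF_filter_not_bot)
      fix \<F> assume "\<F> \<subseteq> \<U>" "finite \<F>"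
      then have "\<Inter>\<F> \<noteq> {}" using fip by blast
      then show "(INF C\<in>\<F>. principal C) \<noteq> bot"
        using \<open>finite \<F>\<close> by (simp add: INF_principal_finite principal_eq_bot_iff)
    qed
    then obtain F where F: "F \<le> (INF C\<in>\<U>. principal C)" "F \<noteq> bot"
      and ultra: "\<And>P. eventually P F \<or> eventually (\<lambda>x. \<not> P x) F"
      by (rule ultrafilter_exists) blast
    have inC: "\<forall>\<^sub>F a in F. a \<in> C" if "C \<in> \<U>" for C
    proof -
      have "F \<le> principal C" using F(1) INF_lower[OF that, of principal] by (rule order_trans)
      then show ?thesis by (simp add: le_principal)
    qed
    obtain C where C: "C \<in> \<U>" using False by blast
    then have "C \<subseteq> carrier G" using cl closedin_subset topspace_eq by blast
    then have Fc: "\<forall>\<^sub>F a in F. a \<in> carrier G" using inC[OF C] by (auto elim: eventually_mono)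
    then obtain l where "limitin T (\<lambda>a. a) l F"
      using complete[OF F(2) Fc ultrafilter_cauchy[OF tb F(2) Fc ultra]] by blast
    then have "l \<in> C" if "C \<in> \<U>" for C
      using limitin_closedin[OF _ _ inC[OF that]] cl that F(2) by blast
    then show ?thesis by blast
  qed simp
qed

end

lemma compact_imp_e_sTG_closed:
  assumes "topspace T = carrier G" "compact_space T"
  shows "e_sTG_closed TYPE('b) G T"
  unfolding e_sTG_closed_def
proof (intro allI impI, elim conjE)
  fix Y :: "'b monoid" and S f
  assume "Hausdorff_space S" "embedding_map T S f"
  then have "continuous_map T S f"
    unfolding embedding_map_def
    by (auto dest!: homeomorphic_imp_continuous_map simp: continuous_map_in_subtopology)
  then have "compactin S (f ` carrier G)"
    using assms image_compactin[of T "topspace T"] by (simp add: compact_space_def)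
  with \<open>Hausdorff_space S\<close> show "closedin S (f ` carrier G)"
    by (rule compactin_imp_closedin)
qed

theorem corollary4p11:
  fixes G :: "('a, 'm) monoid_scheme" and T :: "'a topology"
  assumes "topological_group G T" and "Hausdorff_space T" and "comm_group G"
  shows "compact_space T \<longleftrightarrow> e_sTG_closed TYPE('a + 'b) G T"
proof
  interpret topological_group G T by fact
  interpret comm_group G by fact
  interpret abelian_topological_group G T by unfold_locales
  show "e_sTG_closed TYPE('a + 'b) G T" if "compact_space T"
    using topspace_eq that by (rule compact_imp_e_sTG_closed)
  assume closed: "e_sTG_closed TYPE('a + 'b) G T"
  have size: "carrier G \<lesssim> (UNIV :: ('a + 'b) set)"
    unfolding lepoll_def by (intro exI[of _ Inl]) auto
  show "compact_space T"
    using totally_bounded_complete_imp_compact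
      e_sTG_closed_imp_totally_bounded[OF assms(2) e_sTG_closed_any_type[OF topspace_eq closed size]]
      e_sTG_closed_imp_cauchy_convergent[OF assms(2) e_sTG_closed_any_type[OF topspace_eq closed size]]
    by blast
qed

end
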